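(* Let $\mathbf{P}$ be a small additive category. The functor $M: \mathrm{Aux}(\mathbf{P}) \to \mathrm{Mod}\text{-}\mathbf{P}$ induces a full and faithful functor $\overline{M}: \mathcal{Q}(\mathbf{P}) \rightarrow \mathrm{Mod}\text{-}\mathbf{P}$ that preserves cokernels and images.
   Context: Composition is written diagrammatically: for $\alpha: A \to B$ and $\beta: B \to C$, the composite is $\alpha\cdot\beta: A \to C$. Functors between additive categories are additive. A cospan in $\mathbf{P}$ is a pair of morphisms $(A \xrightarrow{\gamma} B \xleftarrow{\rho} C)$ with common codomain. $\mathrm{Syz}(A \xrightarrow{\gamma} B \xleftarrow{\rho} C)$ is the full subcategory of the slice category of $\mathbf{P}$ over $A$ whose objects, called syzygies, are the morphisms $\sigma: S \to A$ for which there exists $\omega: S \to C$ (a syzygy witness) with $\sigma\cdot\gamma = \omega\cdot\rho$. The additive category $\mathrm{Aux}(\mathbf{P})$ has as objects the cospans $(A \xrightarrow{\gamma_A} \Omega_A \xleftarrow{\rho_A} R_A)$ in $\mathbf{P}$; a morphism from $(A \xrightarrow{\gamma_A} \Omega_A \xleftarrow{\rho_A} R_A)$ to $(B \xrightarrow{\gamma_B} \Omega_B \xleftarrow{\rho_B} R_B)$ is a morphism $\alpha: A \to B$ in $\mathbf{P}$ such that $\sigma \in \mathrm{Syz}(A \xrightarrow{\gamma_A} \Omega_A \xleftarrow{\rho_A} R_A)$ implies $\sigma\cdot\alpha \in \mathrm{Syz}(B \xrightarrow{\gamma_B} \Omega_B \xleftarrow{\rho_B} R_B)$; composition and identities are those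 of $\mathbf{P}$. The ideal $\mathbf{I}(\mathbf{P})$ of $\mathrm{Aux}(\mathbf{P})$ consists of the morphisms $\alpha$ (notation as before) for which there exists $\zeta: A \to R_B$ with $\alpha\cdot\gamma_B = \zeta\cdot\rho_B$. $\mathcal{Q}(\mathbf{P}) := \mathrm{Aux}(\mathbf{P})/\mathbf{I}(\mathbf{P})$ is the additive quotient category; the class of $\alpha$ is denoted $\overline{\alpha}$. The category $\mathcal{Q}(\mathbf{P})$ has cokernels and essentially unique epi-mono factorizations; the image of a morphism is given by the monomorphism of this factorization. $\mathrm{Mod}\text{-}\mathbf{P}$ is the category of additive functors $\mathbf{P}^{\mathrm{op}} \to \mathrm{Ab}$; write $(-,A) := \mathrm{Hom}_{\mathbf{P}}(-,A)$. The functor $M$ sends an object $(A \xrightarrow{\gamma_A} \Omega_A \xleftarrow{\rho_A} R_A)$ to $\frac{\mathrm{im}(-,\gamma_A)}{\mathrm{im}(-,\rho_A)\cap \mathrm{im}(-,\gamma_A)}$ (a subquotient of $(-,\Omega_A)$). With $\epsilon_A: (-,A) \to \frac{\mathrm{im}(-,\gamma_A)}{\mathrm{im}(-,\rho_A)\cap \mathrm{im}(-,\gamma_A)}$ the natural epimorphism (coastriction of $(-,\gamma_A)$ to its image followed by projection), $M(\alpha)$ is, for a morphism $\alpha$ of $\mathrm{Aux}(\mathbf{P})$, the unique morphism with $\epsilon_A \cdot M(\alpha) = (-,\alpha)\cdot \epsilon_B$. That $M$ induces $\overline{M}$ means $\overline{M}(\overline{\alpha}) = M(\alpha)$ and $\overline{M}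 = M$ on objects. *)

theory Defs
  imports "HOL-Algebra.Weak_Morphisms"
begin

section \<open>Preadditive and additive categories\<close>

text \<open>A category enriched in abelian groups. The objects form a set, so every category here is small.
  \<open>Hom C A B\<close> is an abelian group in the multiplicative notation of HOL-Algebra:
  \<open>\<otimes>\<close> is the addition of morphisms and \<open>\<one>\<close> is the zero morphism.
  Hom-sets for different pairs of objects need not be disjoint, which is why composition
  carries its objects. Composition is diagrammatic: \<open>Comp C A B D f g\<close> is first
  \<open>f : A \<rightarrow> B\<close>, then \<open>g : B \<rightarrow> D\<close>.\<close>

record ('o, 'm) category =
  Obj :: "'o set"
  Hom :: "'o \<Rightarrow> 'o \<Rightarrow> 'm monoid"
  Comp :: "'o \<Rightarrow> 'o \<Rightarrow> 'o \<Rightarrow> 'm \<Rightarrow> 'm \<Rightarrow> 'm"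
  Ide :: "'o \<Rightarrow> 'm"

locale preadditive_category =
  fixes C :: "('o, 'm) category"
  assumes hom_comm_group:
    "\<lbrakk>A \<in> Obj C; B \<in> Obj C\<rbrakk> \<Longrightarrow> comm_group (Hom C A B)"
    and comp_closed:
    "\<lbrakk>A \<in> Obj C; B \<in> Obj C; D \<in> Obj C;
      f \<in> carrier (Hom C A B); g \<in> carrier (Hom C B D)\<rbrakk>
      \<Longrightarrow> Comp C A B D f g \<in> carrier (Hom C A D)"
    and ide_closed:
    "A \<in> Obj C \<Longrightarrow> Ide C A \<in> carrier (Hom C A A)"
    and comp_assoc:
    "\<lbrakk>A \<in> Obj C; B \<in> Obj C; D \<in> Obj C; E \<in> Obj C;
      f \<in> carrier (Hom C A B); g \<in> carrier (Hom C B D); h \<in> carrier (Hom C D E)\<rbrakk>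
      \<Longrightarrow> Comp C A D E (Comp C A B D f g) h = Comp C A B E f (Comp C B D E g h)"
    and ide_comp:
    "\<lbrakk>A \<in> Obj C; B \<in> Obj C; f \<in> carrier (Hom C A B)\<rbrakk>
      \<Longrightarrow> Comp C A A B (Ide C A) f = f"
    and comp_ide:
    "\<lbrakk>A \<in> Obj C; B \<in> Obj C; f \<in> carrier (Hom C A B)\<rbrakk>
      \<Longrightarrow> Comp C A B B f (Ide C B) = f"
    and comp_add_left:
    "\<lbrakk>A \<in> Obj C; B \<in> Obj C; D \<in> Obj C;
      f \<in> carrier (Hom C A B); f' \<in> carrier (Hom C A B); g \<in> carrier (Hom C B D)\<rbrakk>
      \<Longrightarrow> Comp C A B D (f \<otimes>\<^bsub>Hom C A B\<^esub> f') g
          = Comp C A B D f g \<otimes>\<^bsub>Hom C A D\<^esub> Comp C A B D f' g"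
    and comp_add_right:
    "\<lbrakk>A \<in> Obj C; B \<in> Obj C; D \<in> Obj C;
      f \<in> carrier (Hom C A B); g \<in> carrier (Hom C B D); g' \<in> carrier (Hom C B D)\<rbrakk>
      \<Longrightarrow> Comp C A B D f (g \<otimes>\<^bsub>Hom C B D\<^esub> g')
          = Comp C A B D f g \<otimes>\<^bsub>Hom C A D\<^esub> Comp C A B D f g'"

definition is_zero_object :: "('o, 'm) category \<Rightarrow> 'o \<Rightarrow> bool" where
  "is_zero_object C Z \<longleftrightarrow> Z \<in> Obj C \<and>
     (\<forall>A\<in>Obj C. carrier (Hom C Z A) = {\<one>\<^bsub>Hom C Z A\<^esub>} \<and>
                 carrier (Hom C A Z) = {\<one>\<^bsub>Hom C A Z\<^esub>})"

definition is_biproduct ::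
  "('o, 'm) category \<Rightarrow> 'o \<Rightarrow> 'o \<Rightarrow> 'o \<Rightarrow> 'm \<Rightarrow> 'm \<Rightarrow> 'm \<Rightarrow> 'm \<Rightarrow> bool" where
  "is_biproduct C A B S i j p q \<longleftrightarrow> S \<in> Obj C \<and>
     i \<in> carrier (Hom C A S) \<and> j \<in> carrier (Hom C B S) \<and>
     p \<in> carrier (Hom C S A) \<and> q \<in> carrier (Hom C S B) \<and>
     Comp C A S A i p = Ide C A \<and> Comp C B S B j q = Ide C B \<and>
     Comp C A S B i q = \<one>\<^bsub>Hom C A B\<^esub> \<and> Comp C B S A j p = \<one>\<^bsub>Hom C B A\<^esub> \<and>
     Comp C S A S p i \<otimes>\<^bsub>Hom C S S\<^esub> Comp C S B S q j = Ide C S"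

locale additive_category = preadditive_category C
  for C :: "('o, 'm) category" +
  assumes ex_zero_object: "\<exists>Z. is_zero_object C Z"
    and ex_biproduct: "\<lbrakk>A \<in> Obj C; B \<in> Obj C\<rbrakk> \<Longrightarrow> \<exists>S i j p q. is_biproduct C A B S i j p q"

definition op_category :: "('o, 'm) category \<Rightarrow> ('o, 'm) category" where
  "op_category C =
     \<lparr>Obj = Obj C,
      Hom = (\<lambda>A B. Hom C B A),
      Comp = (\<lambda>A B D f g. Comp C D B A g f),
      Ide = Ide C\<rparr>"

text \<open>Quotient by a two-sided ideal \<open>I\<close> of morphisms. The union in the composition of two
  cosets is over all representatives (as in \<open>rcoset_mult\<close>) and is again a single coset.\<close>

definition quotient_category ::
  "('o, 'm) category \<Rightarrow> ('o \<Rightarrow> 'o \<Rightarrow> 'm set) \<Rightarrow> ('o, 'm set) category" where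
  "quotient_category C I =
     \<lparr>Obj = Obj C,
      Hom = (\<lambda>A B. Hom C A B Mod I A B),
      Comp = (\<lambda>A B D U V. \<Union>f\<in>U. \<Union>g\<in>V. I A D #>\<^bsub>Hom C A D\<^esub> Comp C A B D f g),
      Ide = (\<lambda>A. I A A #>\<^bsub>Hom C A A\<^esub> Ide C A)\<rparr>"


section \<open>Additive functors and functor categories\<close>

record ('o, 'm, 'p, 'n) funct =
  fobj :: "'o \<Rightarrow> 'p"
  fmor :: "'o \<Rightarrow> 'o \<Rightarrow> 'm \<Rightarrow> 'n"

locale additive_functor =
  source: preadditive_category C + target: preadditive_category D
  for C :: "('o, 'm) category" and D :: "('p, 'n) category" +
  fixes F :: "('o, 'm, 'p, 'n) funct"
  assumes fobj_closed: "A \<in> Obj C \<Longrightarrow> fobj F A \<in> Obj D"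
    and fmor_hom: "\<lbrakk>A \<in> Obj C; B \<in> Obj C\<rbrakk>
      \<Longrightarrow> fmor F A B \<in> hom (Hom C A B) (Hom D (fobj F A) (fobj F B))"
    and fmor_comp: "\<lbrakk>A \<in> Obj C; B \<in> Obj C; E \<in> Obj C;
        f \<in> carrier (Hom C A B); g \<in> carrier (Hom C B E)\<rbrakk>
      \<Longrightarrow> fmor F A E (Comp C A B E f g)
          = Comp D (fobj F A) (fobj F B) (fobj F E) (fmor F A B f) (fmor F B E g)"
    and fmor_ide: "A \<in> Obj C \<Longrightarrow> fmor F A A (Ide C A) = Ide D (fobj F A)"

definition full_functor ::
  "('o, 'm) category \<Rightarrow> ('p, 'n) category \<Rightarrow> ('o, 'm, 'p, 'n) funct \<Rightarrow> bool" where
  "full_functor C D F \<longleftrightarrow> (\<forall>A\<in>Obj C. \<forall>B\<in>Obj C.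
     fmor F A B ` carrier (Hom C A B) = carrier (Hom D (fobj F A) (fobj F B)))"

definition faithful_functor ::
  "('o, 'm) category \<Rightarrow> ('p, 'n) category \<Rightarrow> ('o, 'm, 'p, 'n) funct \<Rightarrow> bool" where
  "faithful_functor C D F \<longleftrightarrow> (\<forall>A\<in>Obj C. \<forall>B\<in>Obj C.
     inj_on (fmor F A B) (carrier (Hom C A B)))"

definition nat_trans ::
  "('o, 'm) category \<Rightarrow> ('p, 'n) category \<Rightarrow> ('o, 'm, 'p, 'n) funct \<Rightarrow> ('o, 'm, 'p, 'n) funct
    \<Rightarrow> ('o \<Rightarrow> 'n) set" where
  "nat_trans C D F G =
     {\<eta> \<in> (\<Pi>\<^sub>E X\<in>Obj C. carrier (Hom D (fobj F X) (fobj G X))).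
       \<forall>X\<in>Obj C. \<forall>Y\<in>Obj C. \<forall>f\<in>carrier (Hom C X Y).
         Comp D (fobj F X) (fobj F Y) (fobj G Y) (fmor F X Y f) (\<eta> Y)
         = Comp D (fobj F X) (fobj G X) (fobj G Y) (\<eta> X) (fmor G X Y f)}"

definition functor_category ::
  "('o, 'm) category \<Rightarrow> ('p, 'n) category
    \<Rightarrow> (('o, 'm, 'p, 'n) funct, 'o \<Rightarrow> 'n) category" where
  "functor_category C D =
     \<lparr>Obj = {F. additive_functor C D F},
      Hom = (\<lambda>F G. \<lparr>carrier = nat_trans C D F G,
        mult = (\<lambda>\<eta> \<theta>. \<lambda>X\<in>Obj C. \<eta> X \<otimes>\<^bsub>Hom D (fobj F X) (fobj G X)\<^esub> \<theta> X),
        one = (\<lambda>X\<in>Obj C. \<one>\<^bsub>Hom D (fobj F X) (fobj G X)\<^esub>)\<rparr>),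
      Comp = (\<lambda>F G H \<eta> \<theta>. \<lambda>X\<in>Obj C. Comp D (fobj F X) (fobj G X) (fobj H X) (\<eta> X) (\<theta> X)),
      Ide = (\<lambda>F. \<lambda>X\<in>Obj C. Ide D (fobj F X))\<rparr>"

text \<open>Abelian groups with carrier in the type \<open>'u\<close>, which plays the role of a universe.\<close>

definition Ab :: "('u monoid, 'u \<Rightarrow> 'u) category" where
  "Ab =
     \<lparr>Obj = {G. comm_group G},
      Hom = (\<lambda>G H. \<lparr>carrier = hom G H \<inter> extensional (carrier G),
        mult = (\<lambda>f g. \<lambda>x\<in>carrier G. f x \<otimes>\<^bsub>H\<^esub> g x),
        one = (\<lambda>x\<in>carrier G. \<one>\<^bsub>H\<^esub>)\<rparr>),
      Comp = (\<lambda>G H K f g. compose (carrier G) g f),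
      Ide = (\<lambda>G. \<lambda>x\<in>carrier G. x)\<rparr>"

type_synonym ('o, 'm, 'u) pmodule = "('o, 'm, 'u monoid, 'u \<Rightarrow> 'u) funct"

definition Mod_cat ::
  "('o, 'm) category \<Rightarrow> (('o, 'm, 'u) pmodule, 'o \<Rightarrow> 'u \<Rightarrow> 'u) category" where
  "Mod_cat P = functor_category (op_category P) Ab"


section \<open>Cokernels and images\<close>

definition is_mono :: "('o, 'm) category \<Rightarrow> 'o \<Rightarrow> 'o \<Rightarrow> 'm \<Rightarrow> bool" where
  "is_mono C A B f \<longleftrightarrow> f \<in> carrier (Hom C A B) \<and>
     (\<forall>T\<in>Obj C. \<forall>u\<in>carrier (Hom C T A). \<forall>v\<in>carrier (Hom C T A).
       Comp C T A B u f = Comp C T A B v f \<longrightarrow> u = v)"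

definition is_epi :: "('o, 'm) category \<Rightarrow> 'o \<Rightarrow> 'o \<Rightarrow> 'm \<Rightarrow> bool" where
  "is_epi C A B f \<longleftrightarrow> f \<in> carrier (Hom C A B) \<and>
     (\<forall>T\<in>Obj C. \<forall>u\<in>carrier (Hom C B T). \<forall>v\<in>carrier (Hom C B T).
       Comp C A B T f u = Comp C A B T f v \<longrightarrow> u = v)"

definition is_cokernel :: "('o, 'm) category \<Rightarrow> 'o \<Rightarrow> 'o \<Rightarrow> 'm \<Rightarrow> 'o \<Rightarrow> 'm \<Rightarrow> bool" where
  "is_cokernel C A B f K q \<longleftrightarrow> K \<in> Obj C \<and> q \<in> carrier (Hom C B K) \<and>
     Comp C A B K f q = \<one>\<^bsub>Hom C A K\<^esub> \<and>
     (\<forall>T\<in>Obj C. \<forall>t\<in>carrier (Hom C B T). Comp C A B T f t = \<one>\<^bsub>Hom C A T\<^esub> \<longrightarrow>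
       (\<exists>!u. u \<in> carrier (Hom C K T) \<and> Comp C B K T q u = t))"

text \<open>The image of \<open>f\<close> is the monomorphism \<open>m : J \<rightarrow> B\<close> of an epi-mono factorization of \<open>f\<close>.\<close>

definition is_image :: "('o, 'm) category \<Rightarrow> 'o \<Rightarrow> 'o \<Rightarrow> 'm \<Rightarrow> 'o \<Rightarrow> 'm \<Rightarrow> bool" where
  "is_image C A B f J m \<longleftrightarrow> J \<in> Obj C \<and> is_mono C J B m \<and>
     (\<exists>e. is_epi C A J e \<and> Comp C A J B e m = f)"

definition preserves_cokernels ::
  "('o, 'm) category \<Rightarrow> ('p, 'n) category \<Rightarrow> ('o, 'm, 'p, 'n) funct \<Rightarrow> bool" where
  "preserves_cokernels C D F \<longleftrightarrow>
     (\<forall>A\<in>Obj C. \<forall>B\<in>Obj C. \<forall>f\<in>carrier (Hom C A B). \<forall>K q. is_cokernel C A B f K q \<longrightarrow>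
       is_cokernel D (fobj F A) (fobj F B) (fmor F A B f) (fobj F K) (fmor F B K q))"

definition preserves_images ::
  "('o, 'm) category \<Rightarrow> ('p, 'n) category \<Rightarrow> ('o, 'm, 'p, 'n) funct \<Rightarrow> bool" where
  "preserves_images C D F \<longleftrightarrow>
     (\<forall>A\<in>Obj C. \<forall>B\<in>Obj C. \<forall>f\<in>carrier (Hom C A B). \<forall>J m. is_image C A B f J m \<longrightarrow>
       is_image D (fobj F A) (fobj F B) (fmor F A B f) (fobj F J) (fmor F J B m))"


section \<open>Cospans, syzygies, and the category \<open>Q(P)\<close>\<close>

text \<open>A cospan \<open>A \<rightarrow>\<gamma> \<Omega> \<leftarrow>\<rho> R\<close>.\<close>

record ('o, 'm) cospan =
  cA :: 'o
  c\<Omega> :: 'o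
  cR :: 'o
  c\<gamma> :: 'm
  c\<rho> :: 'm

definition cospans :: "('o, 'm) category \<Rightarrow> ('o, 'm) cospan set" where
  "cospans P = {K. cA K \<in> Obj P \<and> c\<Omega> K \<in> Obj P \<and> cR K \<in> Obj P \<and>
     c\<gamma> K \<in> carrier (Hom P (cA K) (c\<Omega> K)) \<and> c\<rho> K \<in> carrier (Hom P (cR K) (c\<Omega> K))}"

text \<open>The objects of the category of syzygies; an object \<open>\<sigma> : S \<rightarrow> A\<close> of the slice category
  is the pair \<open>(S, \<sigma>)\<close>.\<close>

definition Syz :: "('o, 'm) category \<Rightarrow> ('o, 'm) cospan \<Rightarrow> ('o \<times> 'm) set" where
  "Syz P K = {(S, \<sigma>). S \<in> Obj P \<and> \<sigma> \<in> carrier (Hom P S (cA K)) \<and>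
     (\<exists>\<omega>\<in>carrier (Hom P S (cR K)).
       Comp P S (cA K) (c\<Omega> K) \<sigma> (c\<gamma> K) = Comp P S (cR K) (c\<Omega> K) \<omega> (c\<rho> K))}"

definition Aux :: "('o, 'm) category \<Rightarrow> (('o, 'm) cospan, 'm) category" where
  "Aux P =
     \<lparr>Obj = cospans P,
      Hom = (\<lambda>K L. (Hom P (cA K) (cA L))\<lparr>carrier :=
        {\<alpha> \<in> carrier (Hom P (cA K) (cA L)).
          \<forall>S \<sigma>. (S, \<sigma>) \<in> Syz P K \<longrightarrow> (S, Comp P S (cA K) (cA L) \<sigma> \<alpha>) \<in> Syz P L}\<rparr>),
      Comp = (\<lambda>K L N. Comp P (cA K) (cA L) (cA N)),
      Ide = (\<lambda>K. Ide P (cA K))\<rparr>"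

definition I_ideal ::
  "('o, 'm) category \<Rightarrow> ('o, 'm) cospan \<Rightarrow> ('o, 'm) cospan \<Rightarrow> 'm set" where
  "I_ideal P K L = {\<alpha> \<in> carrier (Hom (Aux P) K L).
     \<exists>\<zeta>\<in>carrier (Hom P (cA K) (cR L)).
       Comp P (cA K) (cA L) (c\<Omega> L) \<alpha> (c\<gamma> L) = Comp P (cA K) (cR L) (c\<Omega> L) \<zeta> (c\<rho> L)}"

definition Q_cat :: "('o, 'm) category \<Rightarrow> (('o, 'm) cospan, 'm set) category" where
  "Q_cat P = quotient_category (Aux P) (I_ideal P)"

definition Q_class ::
  "('o, 'm) category \<Rightarrow> ('o, 'm) cospan \<Rightarrow> ('o, 'm) cospan \<Rightarrow> 'm \<Rightarrow> 'm set" where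
  "Q_class P K L \<alpha> = I_ideal P K L #>\<^bsub>Hom (Aux P) K L\<^esub> \<alpha>"


section \<open>The functor \<open>M\<close>\<close>

text \<open>The value at \<open>X\<close> of the image of \<open>(-,\<gamma>) : (-,A) \<rightarrow> (-,B)\<close>.\<close>

definition rep_image :: "('o, 'm) category \<Rightarrow> 'o \<Rightarrow> 'o \<Rightarrow> 'm \<Rightarrow> 'o \<Rightarrow> 'm set" where
  "rep_image P A B \<gamma> X = (\<lambda>x. Comp P X A B x \<gamma>) ` carrier (Hom P X A)"

definition M_num :: "('o, 'm) category \<Rightarrow> ('o, 'm) cospan \<Rightarrow> 'o \<Rightarrow> 'm set" where
  "M_num P K X = rep_image P (cA K) (c\<Omega> K) (c\<gamma> K) X"

definition M_den :: "('o, 'm) category \<Rightarrow> ('o, 'm) cospan \<Rightarrow> 'o \<Rightarrow> 'm set" where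
  "M_den P K X = rep_image P (cR K) (c\<Omega> K) (c\<rho> K) X \<inter> M_num P K X"

text \<open>The elements of the subquotient are cosets, of type \<open>'m set\<close>. To let \<open>Mod_cat P\<close> use any
  sufficiently large type \<open>'u\<close> of group elements, they are transported along an injection
  \<open>e : 'm set \<Rightarrow> 'u\<close>. An \<open>f : X \<rightarrow> Y\<close> of \<open>P\<close> is a morphism \<open>Y \<rightarrow> X\<close> of the opposite
  category and acts by sending the coset of \<open>y\<close> to the coset of \<open>f \<cdot> y\<close>.\<close>

definition M_obj ::
  "('o, 'm) category \<Rightarrow> ('m set \<Rightarrow> 'u) \<Rightarrow> ('o, 'm) cospan \<Rightarrow> ('o, 'm, 'u) pmodule" where
  "M_obj P e K =
     \<lparr>fobj = (\<lambda>X. image_group e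
        ((Hom P X (c\<Omega> K))\<lparr>carrier := M_num P K X\<rparr> Mod M_den P K X)),
      fmor = (\<lambda>Y X f.
        \<lambda>u \<in> e ` carrier ((Hom P Y (c\<Omega> K))\<lparr>carrier := M_num P K Y\<rparr> Mod M_den P K Y).
          e (\<Union>y\<in>the_inv e u.
               M_den P K X #>\<^bsub>Hom P X (c\<Omega> K)\<^esub> Comp P X Y (c\<Omega> K) f y))\<rparr>"

definition M_eps ::
  "('o, 'm) category \<Rightarrow> ('m set \<Rightarrow> 'u) \<Rightarrow> ('o, 'm) cospan \<Rightarrow> 'o \<Rightarrow> 'm \<Rightarrow> 'u" where
  "M_eps P e K X x =
     e (M_den P K X #>\<^bsub>Hom P X (c\<Omega> K)\<^esub> Comp P X (cA K) (c\<Omega> K) x (c\<gamma> K))"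

text \<open>The defining equation of \<open>M(\<alpha>)\<close> is written out at each \<open>X\<close> and \<open>x \<in> (X,A)\<close>, because
  \<open>(-,A)\<close> takes values in groups on \<open>'m\<close> rather than \<open>'u\<close>.\<close>

definition M_mor ::
  "('o, 'm) category \<Rightarrow> ('m set \<Rightarrow> 'u) \<Rightarrow> ('o, 'm) cospan \<Rightarrow> ('o, 'm) cospan \<Rightarrow> 'm
    \<Rightarrow> 'o \<Rightarrow> 'u \<Rightarrow> 'u" where
  "M_mor P e K L \<alpha> = (THE \<mu>. \<mu> \<in> carrier (Hom (Mod_cat P) (M_obj P e K) (M_obj P e L)) \<and>
     (\<forall>X\<in>Obj P. \<forall>x\<in>carrier (Hom P X (cA K)).
       \<mu> X (M_eps P e K X x) = M_eps P e L X (Comp P X (cA K) (cA L) x \<alpha>)))"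

definition M_functor ::
  "('o, 'm) category \<Rightarrow> ('m set \<Rightarrow> 'u)
    \<Rightarrow> (('o, 'm) cospan, 'm, ('o, 'm, 'u) pmodule, 'o \<Rightarrow> 'u \<Rightarrow> 'u) funct" where
  "M_functor P e = \<lparr>fobj = M_obj P e, fmor = M_mor P e\<rparr>"

definition induces ::
  "('o, 'm) category \<Rightarrow> (('o, 'm) cospan, 'm, 'p, 'n) funct
    \<Rightarrow> (('o, 'm) cospan, 'm set, 'p, 'n) funct \<Rightarrow> bool" where
  "induces P M Mbar \<longleftrightarrow>
     (\<forall>K\<in>Obj (Aux P). fobj Mbar K = fobj M K) \<and>
     (\<forall>K\<in>Obj (Aux P). \<forall>L\<in>Obj (Aux P). \<forall>\<alpha>\<in>carrier (Hom (Aux P) K L).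
       fmor Mbar K L (Q_class P K L \<alpha>) = fmor M K L \<alpha>)"

end

theory Submission
  imports Defs
begin

text \<open>The natural epimorphism \<open>\<epsilon>\<^sub>K\<close> identifies \<open>M(K)\<close> at \<open>X\<close> with \<open>(X, A\<^sub>K)\<close> modulo the
  syzygies of \<open>K\<close> with source \<open>X\<close>. Hence \<open>\<alpha>\<close> induces a map \<open>M(K) \<rightarrow> M(L)\<close> iff it preserves
  syzygies, and by naturality any such map is determined by its value on the class of the identity
  of \<open>A\<^sub>K\<close>. This value can be prescribed by any \<open>\<alpha>\<close> preserving syzygies (fullness) and vanishes
  iff \<open>\<alpha>\<close> is itself a syzygy of \<open>L\<close>, that is, lies in the ideal (faithfulness).
  The cokernel of \<open>\<alpha> : K \<rightarrow> L\<close> in \<open>Q(P)\<close> is obtained by adjoining \<open>\<alpha> \<cdot> \<gamma>\<^sub>L\<close> to the relations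
  \<open>\<rho>\<^sub>L\<close>, so that its syzygies are those of \<open>L\<close> plus the morphisms factoring through \<open>\<alpha>\<close>; this is
  also the pointwise cokernel. Therefore epimorphisms become pointwise surjective. Monomorphisms
  become pointwise injective, as one sees by testing on cospans without nonzero syzygies; so
  epi-mono factorizations are preserved.\<close>

section \<open>Abelian groups and preadditive categories\<close>

text \<open>An arbitrary epimorphism or cokernel of Q(P) comes without a formula. The explicit
  cospan with adjoined relations therefore serves as a test object: its syzygies over X are exactly
  the elements whose class lies in the image of M(\<alpha>) at X, and the identity of the middle
  object of L is a morphism from L to it. Epimorphisms are tested against this morphism, and an
  arbitrary cokernel is compared with the test object by means of its universal property. Adjoining
  relations requires a direct sum, which is where biproducts of P enter. The groups of M(K) consist
  of cosets transported along \<open>e\<close>, while (-,A) has its groups on the type of morphisms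
  of P, so (-,A) is not an object of the target category. Hence M(\<alpha>) cannot be obtained from
  a universal property inside Mod-P; a descent lemma for families of groups on independent types
  takes its place. Almost all further reasoning uses only that \<epsilon> is onto, natural, and has
  the syzygies as its kernel.\<close>

lemma comm_group_hom_one:
  assumes "comm_group G" "comm_group H" "f \<in> hom G H"
  shows "f \<one>\<^bsub>G\<^esub> = \<one>\<^bsub>H\<^esub>"
  using assms by (intro hom_one) (auto simp: comm_group_def)

lemma comm_group_hom_inv:
  assumes "comm_group G" "comm_group H" "f \<in> hom G H" "x \<in> carrier G"
  shows "f (inv\<^bsub>G\<^esub> x) = inv\<^bsub>H\<^esub> f x"
  using assms by (intro group_hom.hom_inv) (auto simp: comm_group_def group_hom_def group_hom_axioms_def)

lemma (in comm_group) subgroup_imp_comm_group: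
  assumes "subgroup H G"
  shows "comm_group (G\<lparr>carrier := H\<rparr>)"
proof (rule group.group_comm_groupI)
  show "group (G\<lparr>carrier := H\<rparr>)"
    using assms by (intro subgroup.subgroup_is_group) auto
qed (use assms in \<open>auto simp: m_comm subgroup.mem_carrier\<close>)

lemma subgroup_hom_vimage:
  assumes "comm_group G" "comm_group H" "f \<in> hom G H" "subgroup S H"
  shows "subgroup {x \<in> carrier G. f x \<in> S} G"
proof -
  interpret G: comm_group G by fact
  interpret S: subgroup S H by fact
  show ?thesis
    by (rule G.subgroupI)
      (use assms comm_group_hom_one[OF assms(1-3)] in
        \<open>auto simp: comm_group_hom_inv hom_mult S.m_inv_closed comm_group.axioms\<close>)
qed

lemma subgroup_hom_image:
  assumes "comm_group G" "comm_group H" "f \<in> hom G H"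
  shows "subgroup (f ` carrier G) H"
  using assms by (intro group_hom.img_is_subgroup) (auto simp: comm_group_def group_hom_def group_hom_axioms_def)

lemma hom_eq_iff_kernel:
  assumes "comm_group G" "comm_group H" "f \<in> hom G H" "x \<in> carrier G" "y \<in> carrier G"
  shows "f x = f y \<longleftrightarrow> f (x \<otimes>\<^bsub>G\<^esub> inv\<^bsub>G\<^esub> y) = \<one>\<^bsub>H\<^esub>"
proof -
  interpret G: comm_group G by fact
  interpret H: comm_group H by fact
  have "f x \<in> carrier H" "f y \<in> carrier H"
    using assms by (auto simp: hom_def)
  moreover have "f (x \<otimes>\<^bsub>G\<^esub> inv\<^bsub>G\<^esub> y) = f x \<otimes>\<^bsub>H\<^esub> inv\<^bsub>H\<^esub> f y"
    using assms by (simp add: hom_mult comm_group_hom_inv)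
  ultimately show ?thesis
    by (metis H.inv_closed H.inv_equality H.inv_inv H.r_inv)
qed

text \<open>Two preimages of an element differ by a kernel element, so \<open>t\<close> is constant
  on the fibres of \<open>f\<close>. The three groups may live on three types; the extensionality of
  \<open>u\<close> is what makes it unique as a total function.\<close>

lemma ex1_hom_descent:
  assumes "comm_group G" "comm_group H" "comm_group K"
    and f: "f \<in> hom G H" "f ` carrier G = carrier H"
    and t: "t \<in> hom G K"
    and ker: "\<And>x. x \<in> carrier G \<Longrightarrow> f x = \<one>\<^bsub>H\<^esub> \<Longrightarrow> t x = \<one>\<^bsub>K\<^esub>"
  shows "\<exists>!u. u \<in> hom H K \<inter> extensional (carrier H) \<and> (\<forall>x\<in>carrier G. u (f x) = t x)"
proof (rule ex_ex1I)
  interpret G: comm_group G by fact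
  have eq: "t x = t y" if "x \<in> carrier G" "y \<in> carrier G" "f x = f y" for x y
    using that ker hom_eq_iff_kernel[OF assms(1,2) f(1)] hom_eq_iff_kernel[OF assms(1,3) t]
    by (meson G.inv_closed G.m_closed)
  \<comment> \<open>\<open>inv_into\<close> picks some preimage under \<open>f\<close>; by
    \<open>eq\<close> the value does not depend on the choice.\<close>
  define u where "u = (\<lambda>y\<in>carrier H. t (inv_into (carrier G) f y))"
  have uf: "u (f x) = t x" if "x \<in> carrier G" for x
    using that f(2) unfolding u_def
    by (auto intro!: eq simp: inv_into_into f_inv_into_f)
  have "u \<in> hom H K"
    unfolding hom_def
  proof safe
    fix y assume "y \<in> carrier H"
    then show "u y \<in> carrier K"
      using uf f(2) hom_in_carrier[OF t] by (metis imageE)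
  next
    fix y z assume "y \<in> carrier H" "z \<in> carrier H"
    then obtain a b where "y = f a" "z = f b" "a \<in> carrier G" "b \<in> carrier G"
      using f(2) by (metis imageE)
    then show "u (y \<otimes>\<^bsub>H\<^esub> z) = u y \<otimes>\<^bsub>K\<^esub> u z"
      by (metis G.m_closed f(1) hom_mult t uf)
  qed
  then show "\<exists>u. u \<in> hom H K \<inter> extensional (carrier H) \<and> (\<forall>x\<in>carrier G. u (f x) = t x)"
    using uf by (auto simp: u_def)
next
  fix u v
  assume "u \<in> hom H K \<inter> extensional (carrier H) \<and> (\<forall>x\<in>carrier G. u (f x) = t x)"
    and "v \<in> hom H K \<inter> extensional (carrier H) \<and> (\<forall>x\<in>carrier G. v (f x) = t x)"
  then show "u = v"
    using f(2) by (metis (no_types, lifting) IntD2 extensionalityI imageE)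
qed

context comm_group
begin

lemma r_coset_eq_iff:
  assumes "subgroup H G" "x \<in> carrier G" "y \<in> carrier G"
  shows "H #> x = H #> y \<longleftrightarrow> x \<otimes> inv y \<in> H"
  using assms by (metis is_group rcos_self repr_independence subgroup.rcos_module)

text \<open>After transport along \<open>e\<close> the coset map is still a quotient map: a
  surjective homomorphism with kernel \<open>H\<close>. In this form it can be used without handling
  cosets.\<close>

lemma comm_group_image_Mod:
  assumes "subgroup H G" "inj e"
  shows "comm_group (image_group e (G Mod H))"
    and "(\<lambda>x. e (H #> x)) \<in> hom G (image_group e (G Mod H))"
    and "(\<lambda>x. e (H #> x)) ` carrier G = carrier (image_group e (G Mod H))"
    and "\<And>x. x \<in> carrier G \<Longrightarrow> e (H #> x) = \<one>\<^bsub>image_group e (G Mod H)\<^esub> \<longleftrightarrow> x \<in> H"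
proof -
  interpret N: normal H G
    using assms(1) by (rule subgroup_imp_normal)
  interpret Q: comm_group "G Mod H"
    using assms(1) by (rule abelian_FactGroup)
  have inv_e: "inv_into (carrier (G Mod H)) e (e U) = U" if "U \<in> carrier (G Mod H)" for U
    using that assms(2) by (intro inv_into_f_f) (auto intro: inj_on_subset)
  \<comment> \<open>\<open>image_group\<close> multiplies by going back along
    \<open>inv_into\<close> on the carrier, so an injective \<open>e\<close> is an isomorphism onto
    its image.\<close>
  have iso: "e \<in> iso (G Mod H) (image_group e (G Mod H))"
    using assms(2) inv_e
    by (auto simp: iso_def hom_def bij_betw_def image_group_def intro: inj_on_subset)
  show "comm_group (image_group e (G Mod H))"
    using Q.iso_imp_img_comm_group[OF iso] by (simp add: image_group_def)
  show "(\<lambda>x. e (H #> x)) \<in> hom G (image_group e (G Mod H))"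
    using iso N.r_coset_hom_Mod unfolding iso_def hom_def Pi_iff by simp
  show "(\<lambda>x. e (H #> x)) ` carrier G = carrier (image_group e (G Mod H))"
    by (auto simp: image_group_def FactGroup_def RCOSETS_def)
  fix x assume "x \<in> carrier G"
  then show "e (H #> x) = \<one>\<^bsub>image_group e (G Mod H)\<^esub> \<longleftrightarrow> x \<in> H"
    using assms r_coset_eq_iff[OF assms(1), of x \<one>] N.subset
    by (auto simp: image_group_def FactGroup_def inj_eq)
qed

end

context preadditive_category
begin

lemma hom_group: "A \<in> Obj C \<Longrightarrow> B \<in> Obj C \<Longrightarrow> group (Hom C A B)"
  using hom_comm_group by (simp add: comm_group_def)

text \<open>The category axioms give additivity of composition but no laws for zero and inverses;
  reading composition as a group homomorphism in either argument supplies them.\<close>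

lemma postcomp_hom:
  assumes "A \<in> Obj C" "B \<in> Obj C" "D \<in> Obj C" "g \<in> carrier (Hom C B D)"
  shows "(\<lambda>f. Comp C A B D f g) \<in> hom (Hom C A B) (Hom C A D)"
  using assms by (auto simp: hom_def comp_closed comp_add_left)

lemma precomp_hom:
  assumes "A \<in> Obj C" "B \<in> Obj C" "D \<in> Obj C" "f \<in> carrier (Hom C A B)"
  shows "Comp C A B D f \<in> hom (Hom C B D) (Hom C A D)"
  using assms by (auto simp: hom_def comp_closed comp_add_right)

lemma zero_comp:
  assumes "A \<in> Obj C" "B \<in> Obj C" "D \<in> Obj C" "g \<in> carrier (Hom C B D)"
  shows "Comp C A B D \<one>\<^bsub>Hom C A B\<^esub> g = \<one>\<^bsub>Hom C A D\<^esub>"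
  using comm_group_hom_one[OF _ _ postcomp_hom[OF assms]] assms hom_comm_group by blast

lemma comp_zero:
  assumes "A \<in> Obj C" "B \<in> Obj C" "D \<in> Obj C" "f \<in> carrier (Hom C A B)"
  shows "Comp C A B D f \<one>\<^bsub>Hom C B D\<^esub> = \<one>\<^bsub>Hom C A D\<^esub>"
  using comm_group_hom_one[OF _ _ precomp_hom[OF assms]] assms hom_comm_group by blast

lemma comp_inv_left:
  assumes "A \<in> Obj C" "B \<in> Obj C" "D \<in> Obj C" "f \<in> carrier (Hom C A B)" "g \<in> carrier (Hom C B D)"
  shows "Comp C A B D (inv\<^bsub>Hom C A B\<^esub> f) g = inv\<^bsub>Hom C A D\<^esub> (Comp C A B D f g)"
  using comm_group_hom_inv[OF _ _ postcomp_hom[OF assms(1-3,5)] assms(4)] assms hom_comm_group by blast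

lemma comp_inv_right:
  assumes "A \<in> Obj C" "B \<in> Obj C" "D \<in> Obj C" "f \<in> carrier (Hom C A B)" "g \<in> carrier (Hom C B D)"
  shows "Comp C A B D f (inv\<^bsub>Hom C B D\<^esub> g) = inv\<^bsub>Hom C A D\<^esub> (Comp C A B D f g)"
  using comm_group_hom_inv[OF _ _ precomp_hom[OF assms(1-4)] assms(5)] assms hom_comm_group by blast

lemma one_closed_hom: "A \<in> Obj C \<Longrightarrow> B \<in> Obj C \<Longrightarrow> \<one>\<^bsub>Hom C A B\<^esub> \<in> carrier (Hom C A B)"
  using hom_group group.is_monoid monoid.one_closed by blast

lemma preadditive_op_category: "preadditive_category (op_category C)"
  by (rule preadditive_category.intro)
    (simp_all add: op_category_def hom_comm_group comp_closed ide_closed comp_assoc ide_comp comp_ide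
      comp_add_left comp_add_right)

end

lemma comm_group_Ab_hom:
  assumes "comm_group G" "comm_group H"
  shows "comm_group (Hom Ab G H)"
proof -
  interpret G: comm_group G by fact
  interpret H: comm_group H by fact
  show ?thesis
  proof (rule comm_groupI)
    fix f assume f: "f \<in> carrier (Hom Ab G H)"
    \<comment> \<open>Pointwise inversion yields a homomorphism again because \<open>H\<close> is
      commutative.\<close>
    have "(\<lambda>x\<in>carrier G. inv\<^bsub>H\<^esub> f x) \<in> carrier (Hom Ab G H)"
      using f by (auto simp: Ab_def hom_def Pi_iff H.inv_mult)
    moreover have "(\<lambda>x\<in>carrier G. inv\<^bsub>H\<^esub> f x) \<otimes>\<^bsub>Hom Ab G H\<^esub> f = \<one>\<^bsub>Hom Ab G H\<^esub>"
      using f by (auto simp: Ab_def hom_def Pi_iff fun_eq_iff)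
    ultimately show "\<exists>g\<in>carrier (Hom Ab G H). g \<otimes>\<^bsub>Hom Ab G H\<^esub> f = \<one>\<^bsub>Hom Ab G H\<^esub>"
      by blast
  qed (auto simp: Ab_def hom_def Pi_iff fun_eq_iff extensional_def H.m_ac)
qed

lemma preadditive_Ab: "preadditive_category Ab"
proof (rule preadditive_category.intro)
  show "comm_group (Hom Ab G H)" if "G \<in> Obj Ab" "H \<in> Obj Ab" for G H :: "'u monoid"
    using that by (intro comm_group_Ab_hom) (simp_all add: Ab_def)
next
  fix G H K and f g :: "'u \<Rightarrow> 'u"
  assume "G \<in> Obj Ab" "H \<in> Obj Ab" "K \<in> Obj Ab" "f \<in> carrier (Hom Ab G H)" "g \<in> carrier (Hom Ab H K)"
  then have "compose (carrier G) g f \<in> hom G K"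
    by (intro group.hom_compose[of G f H g K]) (simp_all add: Ab_def comm_group.axioms)
  then show "Comp Ab G H K f g \<in> carrier (Hom Ab G K)"
    by (simp add: Ab_def)
next
  fix G H K L and f g h :: "'u \<Rightarrow> 'u"
  assume "f \<in> carrier (Hom Ab G H)" "g \<in> carrier (Hom Ab H K)" "h \<in> carrier (Hom Ab K L)"
  then show "Comp Ab G K L (Comp Ab G H K f g) h = Comp Ab G H L f (Comp Ab H K L g h)"
    by (auto simp: Ab_def compose_def fun_eq_iff dest: hom_in_carrier)
next
  fix G H K and f f' g :: "'u \<Rightarrow> 'u"
  assume "f \<in> carrier (Hom Ab G H)" "f' \<in> carrier (Hom Ab G H)" "g \<in> carrier (Hom Ab H K)"
  then show "Comp Ab G H K (f \<otimes>\<^bsub>Hom Ab G H\<^esub> f') g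
      = Comp Ab G H K f g \<otimes>\<^bsub>Hom Ab G K\<^esub> Comp Ab G H K f' g"
    by (auto simp: Ab_def compose_def fun_eq_iff hom_mult hom_in_carrier)
next
  fix G H K and f g g' :: "'u \<Rightarrow> 'u"
  assume "f \<in> carrier (Hom Ab G H)" "g \<in> carrier (Hom Ab H K)" "g' \<in> carrier (Hom Ab H K)"
  then show "Comp Ab G H K f (g \<otimes>\<^bsub>Hom Ab H K\<^esub> g')
      = Comp Ab G H K f g \<otimes>\<^bsub>Hom Ab G K\<^esub> Comp Ab G H K f g'"
    by (auto simp: Ab_def compose_def fun_eq_iff hom_in_carrier)
qed (auto simp: Ab_def hom_def Pi_iff fun_eq_iff extensional_def compose_def
      comm_group_def comm_monoid_def monoid.m_closed)

section \<open>Functor categories\<close>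

lemma Obj_functor_category: "F \<in> Obj (functor_category C D) \<longleftrightarrow> additive_functor C D F"
  by (simp add: functor_category_def)

lemma carrier_functor_category [simp]: "carrier (Hom (functor_category C D) F G) = nat_trans C D F G"
  by (simp add: functor_category_def)

lemma Comp_functor_category:
  "Comp (functor_category C D) F G H \<eta> \<theta>
     = (\<lambda>X\<in>Obj C. Comp D (fobj F X) (fobj G X) (fobj H X) (\<eta> X) (\<theta> X))"
  by (simp add: functor_category_def)

lemma nat_transD:
  assumes "\<eta> \<in> nat_trans C D F G"
  shows "X \<in> Obj C \<Longrightarrow> \<eta> X \<in> carrier (Hom D (fobj F X) (fobj G X))"
    and "\<eta> \<in> extensional (Obj C)"
    and "X \<in> Obj C \<Longrightarrow> Y \<in> Obj C \<Longrightarrow> f \<in> carrier (Hom C X Y) \<Longrightarrow>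
      Comp D (fobj F X) (fobj F Y) (fobj G Y) (fmor F X Y f) (\<eta> Y)
         = Comp D (fobj F X) (fobj G X) (fobj G Y) (\<eta> X) (fmor G X Y f)"
  using assms by (auto simp: nat_trans_def PiE_iff)

lemma nat_transI:
  assumes "\<And>X. X \<in> Obj C \<Longrightarrow> \<eta> X \<in> carrier (Hom D (fobj F X) (fobj G X))"
    and "\<eta> \<in> extensional (Obj C)"
    and "\<And>X Y f. X \<in> Obj C \<Longrightarrow> Y \<in> Obj C \<Longrightarrow> f \<in> carrier (Hom C X Y) \<Longrightarrow>
      Comp D (fobj F X) (fobj F Y) (fobj G Y) (fmor F X Y f) (\<eta> Y)
         = Comp D (fobj F X) (fobj G X) (fobj G Y) (\<eta> X) (fmor G X Y f)"
  shows "\<eta> \<in> nat_trans C D F G"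
  using assms by (auto simp: nat_trans_def PiE_iff)

context additive_functor
begin

lemma fmor_closed:
  "\<lbrakk>A \<in> Obj C; B \<in> Obj C; f \<in> carrier (Hom C A B)\<rbrakk>
    \<Longrightarrow> fmor F A B f \<in> carrier (Hom D (fobj F A) (fobj F B))"
  using fmor_hom hom_in_carrier by metis

end

context preadditive_category
begin

lemma comm_group_nat_trans:
  assumes "additive_functor B C F" "additive_functor B C G"
  shows "comm_group (Hom (functor_category B C) F G)"
proof -
  interpret F: additive_functor B C F by fact
  interpret G: additive_functor B C G by fact
  let ?H = "\<lambda>X. Hom C (fobj F X) (fobj G X)"
  have grp: "comm_group (?H X)" if "X \<in> Obj B" for X
    using that by (intro hom_comm_group F.fobj_closed G.fobj_closed)
  show ?thesis
  proof (rule comm_groupI)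
    fix \<eta> \<theta>
    assume eta: "\<eta> \<in> carrier (Hom (functor_category B C) F G)"
    then have eta': "\<eta> X \<in> carrier (?H X)" if "X \<in> Obj B" for X
      using that by (simp add: nat_transD)
    let ?i = "\<lambda>X\<in>Obj B. inv\<^bsub>?H X\<^esub> \<eta> X"
    have "?i \<in> carrier (Hom (functor_category B C) F G)"
      unfolding carrier_functor_category
    proof (rule nat_transI)
      fix X Y f assume *: "X \<in> Obj B" "Y \<in> Obj B" "f \<in> carrier (Hom B X Y)"
      then show "Comp C (fobj F X) (fobj F Y) (fobj G Y) (fmor F X Y f) (?i Y)
         = Comp C (fobj F X) (fobj G X) (fobj G Y) (?i X) (fmor G X Y f)"
        using eta by (simp add: comp_inv_left comp_inv_right F.fobj_closed G.fobj_closed eta'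
            F.fmor_closed G.fmor_closed nat_transD(3)[of \<eta> B C F G])
    qed (use eta' grp in \<open>auto intro: group.inv_closed comm_group.axioms\<close>)
    moreover have "?i \<otimes>\<^bsub>Hom (functor_category B C) F G\<^esub> \<eta> = \<one>\<^bsub>Hom (functor_category B C) F G\<^esub>"
      using eta' grp by (auto simp: functor_category_def intro!: restrict_ext group.l_inv comm_group.axioms)
    ultimately show "\<exists>\<theta>\<in>carrier (Hom (functor_category B C) F G).
        \<theta> \<otimes>\<^bsub>Hom (functor_category B C) F G\<^esub> \<eta> = \<one>\<^bsub>Hom (functor_category B C) F G\<^esub>"
      by blast
    show "\<one>\<^bsub>Hom (functor_category B C) F G\<^esub> \<otimes>\<^bsub>Hom (functor_category B C) F G\<^esub> \<eta> = \<eta>"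
      using eta eta' grp
      by (intro extensionalityI[of _ "Obj B"])
        (auto simp: functor_category_def nat_transD(2) comm_group_def comm_monoid_def monoid.l_one)
    assume theta: "\<theta> \<in> carrier (Hom (functor_category B C) F G)"
    then have theta': "\<theta> X \<in> carrier (?H X)" if "X \<in> Obj B" for X
      using that by (simp add: nat_transD)
    have "(\<lambda>X\<in>Obj B. \<eta> X \<otimes>\<^bsub>?H X\<^esub> \<theta> X) \<in> nat_trans B C F G"
    proof (rule nat_transI)
      fix X Y f assume *: "X \<in> Obj B" "Y \<in> Obj B" "f \<in> carrier (Hom B X Y)"
      then show "Comp C (fobj F X) (fobj F Y) (fobj G Y) (fmor F X Y f)
          ((\<lambda>X\<in>Obj B. \<eta> X \<otimes>\<^bsub>?H X\<^esub> \<theta> X) Y)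
         = Comp C (fobj F X) (fobj G X) (fobj G Y) ((\<lambda>X\<in>Obj B. \<eta> X \<otimes>\<^bsub>?H X\<^esub> \<theta> X) X) (fmor G X Y f)"
        using eta theta
        by (simp add: comp_add_left comp_add_right F.fobj_closed G.fobj_closed eta' theta'
            F.fmor_closed G.fmor_closed nat_transD(3)[of _ B C F G])
    qed (use eta' theta' grp in \<open>auto intro!: monoid.m_closed group.is_monoid comm_group.axioms\<close>)
    then show "\<eta> \<otimes>\<^bsub>Hom (functor_category B C) F G\<^esub> \<theta> \<in> carrier (Hom (functor_category B C) F G)"
      by (simp add: functor_category_def)
    show "\<eta> \<otimes>\<^bsub>Hom (functor_category B C) F G\<^esub> \<theta> = \<theta> \<otimes>\<^bsub>Hom (functor_category B C) F G\<^esub> \<eta>"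
      using eta' theta' grp
      by (auto simp: functor_category_def comm_group_def intro!: restrict_ext comm_monoid.m_comm)
    fix \<iota> assume iota: "\<iota> \<in> carrier (Hom (functor_category B C) F G)"
    then have iota': "\<iota> X \<in> carrier (?H X)" if "X \<in> Obj B" for X
      using that by (simp add: nat_transD)
    show "\<eta> \<otimes>\<^bsub>Hom (functor_category B C) F G\<^esub> \<theta> \<otimes>\<^bsub>Hom (functor_category B C) F G\<^esub> \<iota>
        = \<eta> \<otimes>\<^bsub>Hom (functor_category B C) F G\<^esub> (\<theta> \<otimes>\<^bsub>Hom (functor_category B C) F G\<^esub> \<iota>)"
      using eta' theta' iota' grp
      by (auto simp: functor_category_def comm_group_def comm_monoid_def intro!: restrict_ext monoid.m_assoc)
  next
    have "(\<lambda>X\<in>Obj B. \<one>\<^bsub>?H X\<^esub>) \<in> nat_trans B C F G"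
      by (rule nat_transI)
        (simp_all add: one_closed_hom zero_comp comp_zero F.fobj_closed G.fobj_closed F.fmor_closed G.fmor_closed)
    then show "\<one>\<^bsub>Hom (functor_category B C) F G\<^esub> \<in> carrier (Hom (functor_category B C) F G)"
      by (simp add: functor_category_def)
  qed
qed

lemma nat_trans_comp:
  assumes F: "additive_functor B C F" and G: "additive_functor B C G" and H: "additive_functor B C H"
    and eta: "\<eta> \<in> nat_trans B C F G" and theta: "\<theta> \<in> nat_trans B C G H"
  shows "Comp (functor_category B C) F G H \<eta> \<theta> \<in> nat_trans B C F H"
  unfolding Comp_functor_category
proof (rule nat_transI)
  interpret F: additive_functor B C F by fact
  interpret G: additive_functor B C G by fact
  interpret H: additive_functor B C H by fact
  note closed = F.fobj_closed G.fobj_closed H.fobj_closed nat_transD(1)[OF eta] nat_transD(1)[OF theta]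
    F.fmor_closed G.fmor_closed H.fmor_closed comp_closed
  show "(\<lambda>X\<in>Obj B. Comp C (fobj F X) (fobj G X) (fobj H X) (\<eta> X) (\<theta> X)) X
      \<in> carrier (Hom C (fobj F X) (fobj H X))" if "X \<in> Obj B" for X
    using that by (simp add: closed)
  show "(\<lambda>X\<in>Obj B. Comp C (fobj F X) (fobj G X) (fobj H X) (\<eta> X) (\<theta> X)) \<in> extensional (Obj B)"
    by simp
  fix X Y f assume *: "X \<in> Obj B" "Y \<in> Obj B" "f \<in> carrier (Hom B X Y)"
  let ?c = "\<lambda>X. Comp C (fobj F X) (fobj G X) (fobj H X) (\<eta> X) (\<theta> X)"
  have "Comp C (fobj F X) (fobj F Y) (fobj H Y) (fmor F X Y f) (?c Y)
      = Comp C (fobj F X) (fobj G Y) (fobj H Y)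
          (Comp C (fobj F X) (fobj F Y) (fobj G Y) (fmor F X Y f) (\<eta> Y)) (\<theta> Y)"
    using * by (simp add: closed comp_assoc)
  also have "\<dots> = Comp C (fobj F X) (fobj G X) (fobj H Y) (\<eta> X)
          (Comp C (fobj G X) (fobj G Y) (fobj H Y) (fmor G X Y f) (\<theta> Y))"
    using * by (simp add: closed comp_assoc nat_transD(3)[OF eta])
  also have "\<dots> = Comp C (fobj F X) (fobj H X) (fobj H Y) (?c X) (fmor H X Y f)"
    using * by (simp add: closed comp_assoc nat_transD(3)[OF theta])
  finally show "Comp C (fobj F X) (fobj F Y) (fobj H Y) (fmor F X Y f) ((\<lambda>X\<in>Obj B. ?c X) Y)
      = Comp C (fobj F X) (fobj H X) (fobj H Y) ((\<lambda>X\<in>Obj B. ?c X) X) (fmor H X Y f)"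
    using * by simp
qed

lemma nat_trans_ide:
  assumes F: "additive_functor B C F"
  shows "Ide (functor_category B C) F \<in> nat_trans B C F F"
proof -
  interpret F: additive_functor B C F by fact
  show ?thesis
    by (rule nat_transI)
      (auto simp: functor_category_def F.fobj_closed F.fmor_closed ide_closed ide_comp comp_ide)
qed

lemma preadditive_functor_category: "preadditive_category (functor_category B C)"
proof (rule preadditive_category.intro)
  fix F G assume "F \<in> Obj (functor_category B C)" "G \<in> Obj (functor_category B C)"
  then show "comm_group (Hom (functor_category B C) F G)"
    by (simp add: Obj_functor_category comm_group_nat_trans)
next
  fix F G H \<eta> \<theta>
  assume "F \<in> Obj (functor_category B C)" "G \<in> Obj (functor_category B C)" "H \<in> Obj (functor_category B C)"
    "\<eta> \<in> carrier (Hom (functor_category B C) F G)" "\<theta> \<in> carrier (Hom (functor_category B C) G H)"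
  then show "Comp (functor_category B C) F G H \<eta> \<theta> \<in> carrier (Hom (functor_category B C) F H)"
    by (simp add: Obj_functor_category nat_trans_comp)
next
  fix F assume "F \<in> Obj (functor_category B C)"
  then show "Ide (functor_category B C) F \<in> carrier (Hom (functor_category B C) F F)"
    by (simp add: Obj_functor_category nat_trans_ide)
next
  fix F G \<eta>
  assume F: "F \<in> Obj (functor_category B C)" and G: "G \<in> Obj (functor_category B C)"
    and eta: "\<eta> \<in> carrier (Hom (functor_category B C) F G)"
  then have "\<eta> \<in> extensional (Obj B)" "\<And>X. X \<in> Obj B \<Longrightarrow> \<eta> X \<in> carrier (Hom C (fobj F X) (fobj G X))"
    by (auto dest: nat_transD)
  with F G show "Comp (functor_category B C) F F G (Ide (functor_category B C) F) \<eta> = \<eta>"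
    "Comp (functor_category B C) F G G \<eta> (Ide (functor_category B C) G) = \<eta>"
    by (auto intro!: extensionalityI[of _ "Obj B"] simp: Obj_functor_category functor_category_def ide_comp comp_ide
        additive_functor.fobj_closed)
qed (auto simp: Obj_functor_category functor_category_def comp_assoc comp_add_left comp_add_right
      additive_functor.fobj_closed nat_transD(1) intro!: restrict_ext)

end

section \<open>Functors into abelian groups: descent and pointwise criteria\<close>

lemma additive_functor_AbD:
  assumes "additive_functor C Ab F"
  shows "X \<in> Obj C \<Longrightarrow> comm_group (fobj F X)"
    and "X \<in> Obj C \<Longrightarrow> Y \<in> Obj C \<Longrightarrow> f \<in> carrier (Hom C X Y) \<Longrightarrow>
      fmor F X Y f \<in> hom (fobj F X) (fobj F Y) \<inter> extensional (carrier (fobj F X))"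
proof -
  show "comm_group (fobj F X)" if "X \<in> Obj C"
    using additive_functor.fobj_closed[OF assms that] by (simp add: Ab_def)
  show "fmor F X Y f \<in> hom (fobj F X) (fobj F Y) \<inter> extensional (carrier (fobj F X))"
    if "X \<in> Obj C" "Y \<in> Obj C" "f \<in> carrier (Hom C X Y)"
    using additive_functor.fmor_closed[OF assms that] by (simp add: Ab_def)
qed

text \<open>Composition in \<open>Ab\<close> is restricted function composition; unfolding
  naturality to elements once lets the later arguments be elementwise.\<close>

lemma nat_trans_Ab_iff:
  assumes F: "additive_functor C Ab F" and G: "additive_functor C Ab G"
  shows "\<eta> \<in> nat_trans C Ab F G \<longleftrightarrow> \<eta> \<in> extensional (Obj C) \<and>
    (\<forall>X\<in>Obj C. \<eta> X \<in> hom (fobj F X) (fobj G X) \<inter> extensional (carrier (fobj F X))) \<and>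
    (\<forall>X\<in>Obj C. \<forall>Y\<in>Obj C. \<forall>f\<in>carrier (Hom C X Y). \<forall>x\<in>carrier (fobj F X).
      \<eta> Y (fmor F X Y f x) = fmor G X Y f (\<eta> X x))"
proof -
  have "Comp Ab (fobj F X) (fobj F Y) (fobj G Y) (fmor F X Y f) (\<eta> Y)
         = Comp Ab (fobj F X) (fobj G X) (fobj G Y) (\<eta> X) (fmor G X Y f)
      \<longleftrightarrow> (\<forall>x\<in>carrier (fobj F X). \<eta> Y (fmor F X Y f x) = fmor G X Y f (\<eta> X x))" for X Y f
    by (auto simp: Ab_def compose_def fun_eq_iff restrict_def)
  then show ?thesis
    by (auto simp: nat_trans_def PiE_iff) (auto simp: Ab_def)
qed

text \<open>\<open>G\<close> is a mere family of groups with a candidate action \<open>act\<close>,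
  not a functor into \<open>Ab\<close>, so that it can be (-,A) with its groups on the type of
  morphisms. The pointwise descents are natural because each \<open>k X\<close> is onto. This serves
  to construct M(\<alpha>) and, with \<open>act = fmor G\<close>, to factor through
  cokernels.\<close>

lemma ex1_nat_trans_descent:
  assumes H: "additive_functor C Ab H" and T: "additive_functor C Ab T"
    and G: "\<And>X. X \<in> Obj C \<Longrightarrow> comm_group (G X)"
    and k: "\<And>X. X \<in> Obj C \<Longrightarrow> k X \<in> hom (G X) (fobj H X)"
      "\<And>X. X \<in> Obj C \<Longrightarrow> k X ` carrier (G X) = carrier (fobj H X)"
    and t: "\<And>X. X \<in> Obj C \<Longrightarrow> t X \<in> hom (G X) (fobj T X)"
    and act: "\<And>X Y f x. X \<in> Obj C \<Longrightarrow> Y \<in> Obj C \<Longrightarrow> f \<in> carrier (Hom C X Y) \<Longrightarrow> x \<in> carrier (G X) \<Longrightarrow>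
        act X Y f x \<in> carrier (G Y) \<and> k Y (act X Y f x) = fmor H X Y f (k X x)
        \<and> t Y (act X Y f x) = fmor T X Y f (t X x)"
    and ker: "\<And>X x. X \<in> Obj C \<Longrightarrow> x \<in> carrier (G X) \<Longrightarrow> k X x = \<one>\<^bsub>fobj H X\<^esub> \<Longrightarrow> t X x = \<one>\<^bsub>fobj T X\<^esub>"
  shows "\<exists>!u. u \<in> nat_trans C Ab H T \<and> (\<forall>X\<in>Obj C. \<forall>x\<in>carrier (G X). u X (k X x) = t X x)"
proof -
  define P where "P X v \<longleftrightarrow> v \<in> hom (fobj H X) (fobj T X) \<inter> extensional (carrier (fobj H X)) \<and>
      (\<forall>x\<in>carrier (G X). v (k X x) = t X x)" for X v
  have ex1: "\<exists>!v. P X v" if "X \<in> Obj C" for X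
    unfolding P_def using that ker
    by (intro ex1_hom_descent k t G additive_functor_AbD(1)[OF H] additive_functor_AbD(1)[OF T])
  define u where "u = (\<lambda>X\<in>Obj C. THE v. P X v)"
  have u: "P X (u X)" if "X \<in> Obj C" for X
    using that theI'[OF ex1] by (simp add: u_def)
  show ?thesis
  proof (rule ex1I[of _ u])
    have "u Y (fmor H X Y f y) = fmor T X Y f (u X y)"
      if XY: "X \<in> Obj C" "Y \<in> Obj C" "f \<in> carrier (Hom C X Y)" "y \<in> carrier (fobj H X)" for X Y f y
    proof -
      obtain x where "x \<in> carrier (G X)" "y = k X x"
        using k(2) XY by blast
      then show ?thesis
        using act[OF XY(1-3)] u[OF XY(1)] u[OF XY(2)] unfolding P_def by metis
    qed
    then show "u \<in> nat_trans C Ab H T \<and> (\<forall>X\<in>Obj C. \<forall>x\<in>carrier (G X). u X (k X x) = t X x)"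
      using u by (auto simp: nat_trans_Ab_iff[OF H T] P_def) (auto simp: u_def)
    fix v assume *: "v \<in> nat_trans C Ab H T \<and> (\<forall>X\<in>Obj C. \<forall>x\<in>carrier (G X). v X (k X x) = t X x)"
    then have v: "P X (v X)" if "X \<in> Obj C" for X
      using that by (auto simp: nat_trans_Ab_iff[OF H T] P_def)
    show "v = u"
    proof (rule extensionalityI[of _ "Obj C"])
      show "v X = u X" if "X \<in> Obj C" for X
        using that ex1 u v by blast
    qed (use * in \<open>auto simp: u_def nat_trans_Ab_iff[OF H T]\<close>)
  qed
qed

lemma Comp_functor_category_Ab:
  "Comp (functor_category C Ab) F G H \<eta> \<theta> = (\<lambda>X\<in>Obj C. \<lambda>x\<in>carrier (fobj F X). \<theta> X (\<eta> X x))"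
  by (auto simp: Comp_functor_category Ab_def compose_def)

lemma is_mono_functor_category_Ab:
  assumes F: "additive_functor C Ab F" and G: "additive_functor C Ab G"
    and eta: "\<eta> \<in> nat_trans C Ab F G"
    and inj: "\<And>X. X \<in> Obj C \<Longrightarrow> inj_on (\<eta> X) (carrier (fobj F X))"
  shows "is_mono (functor_category C Ab) F G \<eta>"
  unfolding is_mono_def carrier_functor_category Obj_functor_category
proof (intro conjI eta ballI impI)
  fix T u v
  assume "T \<in> Obj (functor_category C Ab)"
    and "u \<in> nat_trans C Ab T F" "v \<in> nat_trans C Ab T F"
    and eq: "Comp (functor_category C Ab) T F G u \<eta> = Comp (functor_category C Ab) T F G v \<eta>"
  then have T: "additive_functor C Ab T" and u: "u \<in> nat_trans C Ab T F" and v: "v \<in> nat_trans C Ab T F"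
    by (simp_all add: Obj_functor_category)
  have "u X x = v X x" if "X \<in> Obj C" "x \<in> carrier (fobj T X)" for X x
  proof (rule inj_onD[OF inj[OF that(1)]])
    show "\<eta> X (u X x) = \<eta> X (v X x)"
      using that fun_cong[OF fun_cong[OF eq, of X], of x] by (simp add: Comp_functor_category_Ab)
  qed (use u v that in \<open>auto simp: nat_trans_Ab_iff[OF T F] intro: hom_in_carrier\<close>)
  then have "u X = v X" if "X \<in> Obj C" for X
    using that u v by (intro extensionalityI[of _ "carrier (fobj T X)"]) (auto simp: nat_trans_Ab_iff[OF T F])
  then show "u = v"
    using u v by (intro extensionalityI[of _ "Obj C"]) (auto simp: nat_trans_Ab_iff[OF T F])
qed

lemma is_epi_functor_category_Ab:
  assumes F: "additive_functor C Ab F" and G: "additive_functor C Ab G"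
    and eta: "\<eta> \<in> nat_trans C Ab F G"
    and surj: "\<And>X. X \<in> Obj C \<Longrightarrow> \<eta> X ` carrier (fobj F X) = carrier (fobj G X)"
  shows "is_epi (functor_category C Ab) F G \<eta>"
  unfolding is_epi_def carrier_functor_category
proof (intro conjI eta ballI impI)
  fix T u v
  assume "T \<in> Obj (functor_category C Ab)"
    and "u \<in> nat_trans C Ab G T" "v \<in> nat_trans C Ab G T"
    and eq: "Comp (functor_category C Ab) F G T \<eta> u = Comp (functor_category C Ab) F G T \<eta> v"
  then have T: "additive_functor C Ab T" and u: "u \<in> nat_trans C Ab G T" and v: "v \<in> nat_trans C Ab G T"
    by (simp_all add: Obj_functor_category)
  have "u X (\<eta> X x) = v X (\<eta> X x)" if "X \<in> Obj C" "x \<in> carrier (fobj F X)" for X x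
    using that fun_cong[OF fun_cong[OF eq, of X], of x] by (simp add: Comp_functor_category_Ab)
  then have "u X = v X" if "X \<in> Obj C" for X
    using that u v surj[OF that, symmetric]
    by (intro extensionalityI[of _ "carrier (fobj G X)"]) (auto simp: nat_trans_Ab_iff[OF G T])
  then show "u = v"
    using u v by (intro extensionalityI[of _ "Obj C"]) (auto simp: nat_trans_Ab_iff[OF G T])
qed

text \<open>Pointwise exactness of F -> G -> H -> 0 is enough: a \<open>t\<close> that vanishes on
  the image of \<open>\<eta>\<close> vanishes on the kernel of \<open>\<theta>\<close> and so
  descends along \<open>\<theta>\<close>.\<close>

lemma is_cokernel_functor_category_Ab:
  assumes F: "additive_functor C Ab F" and G: "additive_functor C Ab G" and H: "additive_functor C Ab H"
    and eta: "\<eta> \<in> nat_trans C Ab F G" and theta: "\<theta> \<in> nat_trans C Ab G H"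
    and surj: "\<And>X. X \<in> Obj C \<Longrightarrow> \<theta> X ` carrier (fobj G X) = carrier (fobj H X)"
    and ker: "\<And>X y. X \<in> Obj C \<Longrightarrow> y \<in> carrier (fobj G X) \<Longrightarrow>
        \<theta> X y = \<one>\<^bsub>fobj H X\<^esub> \<longleftrightarrow> y \<in> \<eta> X ` carrier (fobj F X)"
  shows "is_cokernel (functor_category C Ab) F G \<eta> H \<theta>"
proof -
  have one: "\<one>\<^bsub>Hom (functor_category C Ab) F T\<^esub> = (\<lambda>X\<in>Obj C. \<lambda>x\<in>carrier (fobj F X). \<one>\<^bsub>fobj T X\<^esub>)" for T
    by (auto simp: functor_category_def Ab_def)
  have "Comp (functor_category C Ab) F G H \<eta> \<theta> = \<one>\<^bsub>Hom (functor_category C Ab) F H\<^esub>"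
    using eta ker unfolding one Comp_functor_category_Ab
    by (intro restrict_ext) (auto simp: nat_trans_Ab_iff[OF F G] dest: hom_in_carrier)
  moreover have "\<exists>!u. u \<in> nat_trans C Ab H T \<and> Comp (functor_category C Ab) G H T \<theta> u = t"
    if "T \<in> Obj (functor_category C Ab)" and "t \<in> nat_trans C Ab G T"
      and zero: "Comp (functor_category C Ab) F G T \<eta> t = \<one>\<^bsub>Hom (functor_category C Ab) F T\<^esub>" for T t
  proof -
    have T: "additive_functor C Ab T" and t: "t \<in> nat_trans C Ab G T"
      using that by (simp_all add: Obj_functor_category)
    have *: "t X (\<eta> X x) = \<one>\<^bsub>fobj T X\<^esub>" if "X \<in> Obj C" "x \<in> carrier (fobj F X)" for X x
      using that fun_cong[OF fun_cong[OF zero, of X], of x] by (simp add: Comp_functor_category_Ab one)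
    have "\<exists>!u. u \<in> nat_trans C Ab H T \<and> (\<forall>X\<in>Obj C. \<forall>x\<in>carrier (fobj G X). u X (\<theta> X x) = t X x)"
    proof (rule ex1_nat_trans_descent[OF H T, where G = "fobj G" and act = "fmor G"])
      fix X Y f x assume "X \<in> Obj C" "Y \<in> Obj C" "f \<in> carrier (Hom C X Y)" "x \<in> carrier (fobj G X)"
      moreover from this have "fmor G X Y f x \<in> carrier (fobj G Y)"
        using additive_functor_AbD(2)[OF G] by (blast intro: hom_in_carrier)
      ultimately show "fmor G X Y f x \<in> carrier (fobj G Y) \<and> \<theta> Y (fmor G X Y f x) = fmor H X Y f (\<theta> X x)
          \<and> t Y (fmor G X Y f x) = fmor T X Y f (t X x)"
        using theta t by (simp add: nat_trans_Ab_iff[OF G H] nat_trans_Ab_iff[OF G T])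
    next
      fix X x assume "X \<in> Obj C" "x \<in> carrier (fobj G X)" "\<theta> X x = \<one>\<^bsub>fobj H X\<^esub>"
      then show "t X x = \<one>\<^bsub>fobj T X\<^esub>"
        using * by (auto simp: ker)
    qed (use theta t surj additive_functor_AbD(1)[OF G] in
        \<open>auto simp: nat_trans_Ab_iff[OF G H] nat_trans_Ab_iff[OF G T]\<close>)
    \<comment> \<open>The equation of a factorization is the pointwise condition of the descent
      lemma, so unique existence carries over.\<close>
    moreover have "Comp (functor_category C Ab) G H T \<theta> u = t \<longleftrightarrow>
        (\<forall>X\<in>Obj C. \<forall>x\<in>carrier (fobj G X). u X (\<theta> X x) = t X x)" for u
      using t unfolding Comp_functor_category_Ab nat_trans_Ab_iff[OF G T]
      by (auto intro!: extensionalityI[of _ "Obj C"] extensionalityI[of _ "carrier (fobj G _)"])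
    ultimately show ?thesis
      by simp
  qed
  ultimately show ?thesis
    using H theta by (auto simp: is_cokernel_def Obj_functor_category)
qed

section \<open>Quotient categories\<close>

locale category_ideal = preadditive_category C for C :: "('o, 'm) category" +
  fixes I :: "'o \<Rightarrow> 'o \<Rightarrow> 'm set"
  assumes ideal_subgroup: "\<lbrakk>A \<in> Obj C; B \<in> Obj C\<rbrakk> \<Longrightarrow> subgroup (I A B) (Hom C A B)"
    and ideal_comp_right: "\<lbrakk>A \<in> Obj C; B \<in> Obj C; D \<in> Obj C; f \<in> I A B; g \<in> carrier (Hom C B D)\<rbrakk>
      \<Longrightarrow> Comp C A B D f g \<in> I A D"
    and ideal_comp_left: "\<lbrakk>A \<in> Obj C; B \<in> Obj C; D \<in> Obj C; f \<in> carrier (Hom C A B); g \<in> I B D\<rbrakk>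
      \<Longrightarrow> Comp C A B D f g \<in> I A D"
begin

abbreviation cls :: "'o \<Rightarrow> 'o \<Rightarrow> 'm \<Rightarrow> 'm set" where
  "cls A B f \<equiv> I A B #>\<^bsub>Hom C A B\<^esub> f"

lemma quotient_simps [simp]:
  "Obj (quotient_category C I) = Obj C"
  "Hom (quotient_category C I) A B = Hom C A B Mod I A B"
  "Ide (quotient_category C I) A = cls A A (Ide C A)"
  by (simp_all add: quotient_category_def)

lemma carrier_quotient: "carrier (Hom C A B Mod I A B) = cls A B ` carrier (Hom C A B)"
  by (auto simp: FactGroup_def RCOSETS_def)

lemma cls_eq_iff:
  assumes "A \<in> Obj C" "B \<in> Obj C" "f \<in> carrier (Hom C A B)" "g \<in> carrier (Hom C A B)"
  shows "cls A B f = cls A B g \<longleftrightarrow> f \<otimes>\<^bsub>Hom C A B\<^esub> inv\<^bsub>Hom C A B\<^esub> g \<in> I A B"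
  using assms comm_group.r_coset_eq_iff[OF hom_comm_group ideal_subgroup] by blast

text \<open>The neutral element of the quotient group is the coset \<open>I A B\<close> itself, so
  this is the test for a morphism to become zero.\<close>

lemma cls_eq_ideal_iff:
  assumes "A \<in> Obj C" "B \<in> Obj C" "f \<in> carrier (Hom C A B)"
  shows "cls A B f = I A B \<longleftrightarrow> f \<in> I A B"
proof -
  interpret comm_group "Hom C A B"
    using assms(1,2) by (rule hom_comm_group)
  show ?thesis
    using assms cls_eq_iff[of A B f "\<one>\<^bsub>Hom C A B\<^esub>"] subgroup.subset[OF ideal_subgroup]
    by (auto simp: FactGroup_def)
qed

lemma cls_mult:
  assumes "A \<in> Obj C" "B \<in> Obj C" "f \<in> carrier (Hom C A B)" "g \<in> carrier (Hom C A B)"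
  shows "cls A B f <#>\<^bsub>Hom C A B\<^esub> cls A B g = cls A B (f \<otimes>\<^bsub>Hom C A B\<^esub> g)"
  using assms normal.rcos_sum[OF comm_group.subgroup_imp_normal[OF hom_comm_group ideal_subgroup]]
  by simp

lemma cls_self:
  assumes "A \<in> Obj C" "B \<in> Obj C" "f \<in> carrier (Hom C A B)"
  shows "f \<in> cls A B f"
  using assms group.rcos_self[OF hom_group] ideal_subgroup by blast

lemma mem_cls_iff:
  assumes "A \<in> Obj C" "B \<in> Obj C" "f \<in> carrier (Hom C A B)"
  shows "f' \<in> cls A B f \<longleftrightarrow> f' \<in> carrier (Hom C A B) \<and> cls A B f' = cls A B f"
proof
  assume "f' \<in> cls A B f"
  moreover from this have "f' \<in> carrier (Hom C A B)"
    using assms monoid.r_coset_subset_G[OF group.is_monoid[OF hom_group]] subgroup.subset[OF ideal_subgroup] by blast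
  ultimately show "f' \<in> carrier (Hom C A B) \<and> cls A B f' = cls A B f"
    using assms group.repr_independence[OF hom_group] ideal_subgroup by blast
qed (use assms cls_self in blast)

text \<open>One factor is replaced at a time: each difference of composites is a composite with one
  factor in the ideal.\<close>

lemma cls_comp_cong:
  assumes "A \<in> Obj C" "B \<in> Obj C" "D \<in> Obj C"
    and f: "f \<in> carrier (Hom C A B)" "f' \<in> carrier (Hom C A B)" "cls A B f = cls A B f'"
    and g: "g \<in> carrier (Hom C B D)" "g' \<in> carrier (Hom C B D)" "cls B D g = cls B D g'"
  shows "cls A D (Comp C A B D f g) = cls A D (Comp C A B D f' g')"
proof -
  interpret AB: comm_group "Hom C A B" using assms(1,2) by (rule hom_comm_group)
  interpret BD: comm_group "Hom C B D" using assms(2,3) by (rule hom_comm_group)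
  have "Comp C A B D f g \<otimes>\<^bsub>Hom C A D\<^esub> inv\<^bsub>Hom C A D\<^esub> Comp C A B D f' g
      = Comp C A B D (f \<otimes>\<^bsub>Hom C A B\<^esub> inv\<^bsub>Hom C A B\<^esub> f') g"
    using assms by (simp add: comp_add_left comp_inv_left)
  then have 1: "cls A D (Comp C A B D f g) = cls A D (Comp C A B D f' g)"
    using assms by (simp add: cls_eq_iff comp_closed ideal_comp_right)
  have "Comp C A B D f' g \<otimes>\<^bsub>Hom C A D\<^esub> inv\<^bsub>Hom C A D\<^esub> Comp C A B D f' g'
      = Comp C A B D f' (g \<otimes>\<^bsub>Hom C B D\<^esub> inv\<^bsub>Hom C B D\<^esub> g')"
    using assms by (simp add: comp_add_right comp_inv_right)
  then have 2: "cls A D (Comp C A B D f' g) = cls A D (Comp C A B D f' g')"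
    using assms by (simp add: cls_eq_iff comp_closed ideal_comp_left)
  show ?thesis
    using 1 2 by simp
qed

text \<open>All cosets in the double union coincide by \<open>cls_comp_cong\<close>, and the index
  sets are nonempty because a coset contains its representative.\<close>

lemma cls_comp:
  assumes "A \<in> Obj C" "B \<in> Obj C" "D \<in> Obj C" "f \<in> carrier (Hom C A B)" "g \<in> carrier (Hom C B D)"
  shows "Comp (quotient_category C I) A B D (cls A B f) (cls B D g) = cls A D (Comp C A B D f g)"
proof -
  have *: "cls A D (Comp C A B D f' g') = cls A D (Comp C A B D f g)"
    if "f' \<in> cls A B f" "g' \<in> cls B D g" for f' g'
    using that assms by (intro cls_comp_cong) (auto simp: mem_cls_iff)
  have "Comp (quotient_category C I) A B D (cls A B f) (cls B D g)
      = (\<Union>f'\<in>cls A B f. \<Union>g'\<in>cls B D g. cls A D (Comp C A B D f' g'))"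
    by (simp add: quotient_category_def)
  also have "\<dots> = (\<Union>f'\<in>cls A B f. \<Union>g'\<in>cls B D g. cls A D (Comp C A B D f g))"
    by (intro SUP_cong refl) (rule *)
  also have "\<dots> = cls A D (Comp C A B D f g)"
    using assms cls_self[of A B f] cls_self[of B D g] by auto
  finally show ?thesis .
qed

lemma preadditive_quotient: "preadditive_category (quotient_category C I)"
proof (rule preadditive_category.intro)
  fix A B assume "A \<in> Obj (quotient_category C I)" "B \<in> Obj (quotient_category C I)"
  then show "comm_group (Hom (quotient_category C I) A B)"
    by (simp add: comm_group.abelian_FactGroup hom_comm_group ideal_subgroup)
qed (auto simp: carrier_quotient cls_comp cls_mult comp_closed ide_closed comp_assoc ide_comp comp_ide
    comp_add_left comp_add_right group.is_monoid hom_group monoid.m_closed)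

end

section \<open>Functors induced on a quotient category\<close>

locale ideal_killing_functor = category_ideal C I + additive_functor C D F
  for C :: "('o, 'm) category" and I and D :: "('p, 'n) category" and F :: "('o, 'm, 'p, 'n) funct" +
  assumes kills: "\<lbrakk>A \<in> Obj C; B \<in> Obj C; f \<in> I A B\<rbrakk> \<Longrightarrow> fmor F A B f = \<one>\<^bsub>Hom D (fobj F A) (fobj F B)\<^esub>"
begin

text \<open>\<open>the_elem\<close> reads off the single value of \<open>F\<close> on a coset; it is
  single because two representatives differ by a morphism that \<open>F\<close> kills.\<close>

definition induced :: "('o, 'm set, 'p, 'n) funct" where
  "induced = \<lparr>fobj = fobj F, fmor = (\<lambda>A B U. the_elem (fmor F A B ` U))\<rparr>"

lemma fobj_induced [simp]: "fobj induced = fobj F"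
  by (simp add: induced_def)

lemma fmor_induced:
  assumes "A \<in> Obj C" "B \<in> Obj C" "f \<in> carrier (Hom C A B)"
  shows "fmor induced A B (cls A B f) = fmor F A B f"
proof -
  have "fmor F A B f' = fmor F A B f" if "f' \<in> cls A B f" for f'
  proof -
    have "f' \<in> carrier (Hom C A B)" "f' \<otimes>\<^bsub>Hom C A B\<^esub> inv\<^bsub>Hom C A B\<^esub> f \<in> I A B"
      using that assms by (auto simp: mem_cls_iff cls_eq_iff)
    then show ?thesis
      using assms hom_eq_iff_kernel[OF hom_comm_group target.hom_comm_group fmor_hom] kills fobj_closed
      by blast
  qed
  then have "fmor F A B ` cls A B f = {fmor F A B f}"
    using assms cls_self by blast
  then show ?thesis
    by (simp add: induced_def)
qed

lemma additive_functor_induced: "additive_functor (quotient_category C I) D induced"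
proof (intro additive_functor.intro additive_functor_axioms.intro preadditive_quotient
    target.preadditive_category_axioms)
  fix A B assume "A \<in> Obj (quotient_category C I)" "B \<in> Obj (quotient_category C I)"
  then show "fmor induced A B \<in> hom (Hom (quotient_category C I) A B) (Hom D (fobj induced A) (fobj induced B))"
    using group.is_monoid[OF hom_group]
    by (auto simp: hom_def carrier_quotient fmor_induced fmor_closed cls_mult monoid.m_closed
        hom_mult[OF fmor_hom])
qed (auto simp: fobj_closed carrier_quotient cls_comp fmor_induced fmor_comp fmor_ide comp_closed ide_closed)

end

section \<open>Syzygies\<close>

lemma cospansD:
  assumes "K \<in> cospans P"
  shows "cA K \<in> Obj P" "c\<Omega> K \<in> Obj P" "cR K \<in> Obj P"
    "c\<gamma> K \<in> carrier (Hom P (cA K) (c\<Omega> K))" "c\<rho> K \<in> carrier (Hom P (cR K) (c\<Omega> K))"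
  using assms by (simp_all add: cospans_def)

lemma Aux_simps [simp]:
  "Obj (Aux P) = cospans P"
  "Comp (Aux P) K L N = Comp P (cA K) (cA L) (cA N)"
  "Ide (Aux P) K = Ide P (cA K)"
  "mult (Hom (Aux P) K L) = mult (Hom P (cA K) (cA L))"
  "one (Hom (Aux P) K L) = one (Hom P (cA K) (cA L))"
  by (simp_all add: Aux_def)

lemma Hom_Aux_iff:
  "\<alpha> \<in> carrier (Hom (Aux P) K L) \<longleftrightarrow> \<alpha> \<in> carrier (Hom P (cA K) (cA L)) \<and>
     (\<forall>S \<sigma>. (S, \<sigma>) \<in> Syz P K \<longrightarrow> (S, Comp P S (cA K) (cA L) \<sigma> \<alpha>) \<in> Syz P L)"
  by (simp add: Aux_def)

lemma Hom_Aux: "Hom (Aux P) K L = (Hom P (cA K) (cA L))\<lparr>carrier := carrier (Hom (Aux P) K L)\<rparr>"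
  by (simp add: Aux_def)

lemma Hom_AuxD: "\<alpha> \<in> carrier (Hom (Aux P) K L) \<Longrightarrow> \<alpha> \<in> carrier (Hom P (cA K) (cA L))"
  by (simp add: Hom_Aux_iff)

lemma SyzD: "(X, x) \<in> Syz P K \<Longrightarrow> X \<in> Obj P" "(X, x) \<in> Syz P K \<Longrightarrow> x \<in> carrier (Hom P X (cA K))"
  by (auto simp: Syz_def)

text \<open>Existence of a witness becomes membership in a subgroup, the form in which the
  group-theoretic facts and the comparison with \<open>M_den\<close> apply.\<close>

lemma Syz_iff:
  "(X, x) \<in> Syz P K \<longleftrightarrow> X \<in> Obj P \<and> x \<in> carrier (Hom P X (cA K)) \<and>
     Comp P X (cA K) (c\<Omega> K) x (c\<gamma> K) \<in> rep_image P (cR K) (c\<Omega> K) (c\<rho> K) X"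
  by (auto simp: Syz_def rep_image_def)

text \<open>The morphism \<open>\<zeta>\<close> in the definition of the ideal is a syzygy witness
  over \<open>cA K\<close>. Hence the ideal is governed by the same condition as the kernel of the
  natural epimorphism.\<close>

lemma I_ideal_iff:
  "K \<in> cospans P \<Longrightarrow> \<alpha> \<in> I_ideal P K L \<longleftrightarrow> \<alpha> \<in> carrier (Hom (Aux P) K L) \<and> (cA K, \<alpha>) \<in> Syz P L"
  by (auto simp: I_ideal_def Syz_def Hom_Aux_iff dest: cospansD)

context preadditive_category
begin

lemma rep_image_subgroup:
  assumes "A \<in> Obj C" "B \<in> Obj C" "\<gamma> \<in> carrier (Hom C A B)" "X \<in> Obj C"
  shows "subgroup (rep_image C A B \<gamma> X) (Hom C X B)"
  unfolding rep_image_def using assms by (intro subgroup_hom_image postcomp_hom hom_comm_group)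

lemma rep_image_precomp:
  assumes "A \<in> Obj C" "B \<in> Obj C" "\<gamma> \<in> carrier (Hom C A B)" "X \<in> Obj C" "Y \<in> Obj C"
    and "f \<in> carrier (Hom C Y X)" "x \<in> rep_image C A B \<gamma> X"
  shows "Comp C Y X B f x \<in> rep_image C A B \<gamma> Y"
  using assms by (auto simp: rep_image_def comp_assoc[symmetric] comp_closed)

text \<open>The syzygies over \<open>X\<close> are the preimage of the subgroup of multiples of
  \<open>c\<rho> K\<close> under composition with \<open>c\<gamma> K\<close>.\<close>

lemma Syz_subgroup:
  assumes "K \<in> cospans C" "X \<in> Obj C"
  shows "subgroup {x. (X, x) \<in> Syz C K} (Hom C X (cA K))"
proof -
  note K = cospansD[OF assms(1)]
  have "subgroup {x \<in> carrier (Hom C X (cA K)). Comp C X (cA K) (c\<Omega> K) x (c\<gamma> K)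
      \<in> rep_image C (cR K) (c\<Omega> K) (c\<rho> K) X} (Hom C X (cA K))"
    using K assms(2)
    by (intro subgroup_hom_vimage[OF hom_comm_group hom_comm_group postcomp_hom] rep_image_subgroup)
  then show ?thesis
    using assms(2) by (simp add: Syz_iff)
qed

text \<open>Precomposing a witness with \<open>f\<close> gives a witness again, so the syzygies form
  a subfunctor of (-,A).\<close>

lemma Syz_precomp:
  assumes "K \<in> cospans C" "Y \<in> Obj C" "f \<in> carrier (Hom C Y X)" "(X, x) \<in> Syz C K"
  shows "(Y, Comp C Y X (cA K) f x) \<in> Syz C K"
proof -
  note K = cospansD[OF assms(1)] SyzD[OF assms(4)]
  then show ?thesis
    using assms rep_image_precomp[of "cR K" "c\<Omega> K" "c\<rho> K" X Y f]
    by (simp add: Syz_iff comp_closed comp_assoc)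
qed

lemma Aux_subgroup:
  assumes "K \<in> cospans C" "L \<in> cospans C"
  shows "subgroup (carrier (Hom (Aux C) K L)) (Hom C (cA K) (cA L))"
proof -
  note KL = cospansD[OF assms(1)] cospansD[OF assms(2)]
  interpret KL: comm_group "Hom C (cA K) (cA L)"
    using KL by (intro hom_comm_group)
  note Syz = subgroup.one_closed[OF Syz_subgroup] subgroup.m_closed[OF Syz_subgroup]
    group.subgroupE(3)[OF hom_group Syz_subgroup]
  show ?thesis
  proof (rule KL.subgroupI)
    have "\<one>\<^bsub>Hom C (cA K) (cA L)\<^esub> \<in> carrier (Hom (Aux C) K L)"
      using KL Syz(1)[OF assms(2)] by (auto simp: Hom_Aux_iff comp_zero SyzD)
    then show "carrier (Hom (Aux C) K L) \<noteq> {}" by blast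
  next
    fix \<alpha> assume "\<alpha> \<in> carrier (Hom (Aux C) K L)"
    then show "inv\<^bsub>Hom C (cA K) (cA L)\<^esub> \<alpha> \<in> carrier (Hom (Aux C) K L)"
      using KL Syz(3)[OF _ _ assms(2)] by (auto simp: Hom_Aux_iff comp_inv_right SyzD)
  next
    fix \<alpha> \<beta> assume "\<alpha> \<in> carrier (Hom (Aux C) K L)" "\<beta> \<in> carrier (Hom (Aux C) K L)"
    then show "\<alpha> \<otimes>\<^bsub>Hom C (cA K) (cA L)\<^esub> \<beta> \<in> carrier (Hom (Aux C) K L)"
      using KL Syz(2)[OF assms(2)] by (auto simp: Hom_Aux_iff comp_add_right SyzD)
  qed (auto simp: Hom_Aux_iff)
qed

lemma preadditive_Aux: "preadditive_category (Aux C)"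
proof (rule preadditive_category.intro)
  fix K L assume "K \<in> Obj (Aux C)" "L \<in> Obj (Aux C)"
  then show "comm_group (Hom (Aux C) K L)"
    by (subst Hom_Aux) (auto intro!: comm_group.subgroup_imp_comm_group Aux_subgroup hom_comm_group cospansD)
next
  fix K L N \<alpha> \<beta>
  assume "K \<in> Obj (Aux C)" "L \<in> Obj (Aux C)" "N \<in> Obj (Aux C)"
    "\<alpha> \<in> carrier (Hom (Aux C) K L)" "\<beta> \<in> carrier (Hom (Aux C) L N)"
  then show "Comp (Aux C) K L N \<alpha> \<beta> \<in> carrier (Hom (Aux C) K N)"
    by (auto simp: Hom_Aux_iff cospansD comp_closed SyzD comp_assoc[symmetric])
qed (auto simp: Hom_Aux_iff cospansD ide_closed comp_assoc ide_comp comp_ide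
      comp_add_left comp_add_right SyzD)

text \<open>Differences in Q(P) are formed in the hom group of \<open>Aux C\<close>, those tested by
  syzygies in the hom group of P; this reconciles them.\<close>

lemma inv_Aux:
  assumes "K \<in> cospans C" "L \<in> cospans C" "\<alpha> \<in> carrier (Hom (Aux C) K L)"
  shows "inv\<^bsub>Hom (Aux C) K L\<^esub> \<alpha> = inv\<^bsub>Hom C (cA K) (cA L)\<^esub> \<alpha>"
  using assms by (subst Hom_Aux) (simp add: group.m_inv_consistent hom_group cospansD Aux_subgroup)

text \<open>Closure on the right is the defining property of a morphism \<open>\<beta>\<close> of
  \<open>Aux C\<close>, applied to the syzygy \<open>\<alpha>\<close>; closure on the left is
  \<open>Syz_precomp\<close>.\<close>

lemma category_ideal_I_ideal: "category_ideal (Aux C) (I_ideal C)"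
proof (intro category_ideal.intro preadditive_Aux category_ideal_axioms.intro)
  fix K L assume KL: "K \<in> Obj (Aux C)" "L \<in> Obj (Aux C)"
  have "I_ideal C K L = {\<alpha> \<in> carrier (Hom (Aux C) K L). \<alpha> \<in> {x. (cA K, x) \<in> Syz C L}}"
    using KL by (auto simp: I_ideal_iff)
  moreover have "(\<lambda>\<alpha>. \<alpha>) \<in> hom (Hom (Aux C) K L) (Hom C (cA K) (cA L))"
    by (auto simp: hom_def Hom_Aux_iff)
  ultimately show "subgroup (I_ideal C K L) (Hom (Aux C) K L)"
    using KL subgroup_hom_vimage[OF preadditive_category.hom_comm_group[OF preadditive_Aux KL] _ _ Syz_subgroup]
    by (simp add: hom_comm_group cospansD)
next
  fix K L N \<alpha> \<beta>
  assume KLN: "K \<in> Obj (Aux C)" "L \<in> Obj (Aux C)" "N \<in> Obj (Aux C)"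
  { assume "\<alpha> \<in> I_ideal C K L" "\<beta> \<in> carrier (Hom (Aux C) L N)"
    with KLN show "Comp (Aux C) K L N \<alpha> \<beta> \<in> I_ideal C K N"
      using preadditive_category.comp_closed[OF preadditive_Aux KLN, of \<alpha> \<beta>]
      by (auto simp: I_ideal_iff Hom_Aux_iff[of \<beta>]) }
  { assume "\<alpha> \<in> carrier (Hom (Aux C) K L)" "\<beta> \<in> I_ideal C L N"
    with KLN show "Comp (Aux C) K L N \<alpha> \<beta> \<in> I_ideal C K N"
      using preadditive_category.comp_closed[OF preadditive_Aux KLN, of \<alpha> \<beta>]
      by (auto simp: I_ideal_iff Hom_Aux_iff[of \<alpha>] cospansD intro: Syz_precomp) }
qed

end

section \<open>The modules M(K) and their natural epimorphisms\<close>

locale cospan_modules = preadditive_category C for C :: "('o, 'm) category" +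
  fixes e :: "'m set \<Rightarrow> 'u"
  assumes inj_e: "inj e"
begin

abbreviation M :: "('o, 'm) cospan \<Rightarrow> ('o, 'm, 'u) pmodule" where
  "M \<equiv> M_obj C e"

abbreviation eps :: "('o, 'm) cospan \<Rightarrow> 'o \<Rightarrow> 'm \<Rightarrow> 'u" where
  "eps \<equiv> M_eps C e"

context
  fixes K X
  assumes K: "K \<in> cospans C" and X: "X \<in> Obj C"
begin

lemma M_num_subgroup: "subgroup (M_num C K X) (Hom C X (c\<Omega> K))"
  unfolding M_num_def using K X by (intro rep_image_subgroup cospansD)

lemma comm_group_M_num: "comm_group ((Hom C X (c\<Omega> K))\<lparr>carrier := M_num C K X\<rparr>)"
  using M_num_subgroup K X by (intro comm_group.subgroup_imp_comm_group hom_comm_group cospansD)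

lemma M_den_subgroup: "subgroup (M_den C K X) (Hom C X (c\<Omega> K))"
  unfolding M_den_def using M_num_subgroup K X
  by (intro group.subgroups_Inter_pair hom_group rep_image_subgroup cospansD) auto

lemma M_den_subgroup_M_num:
  "subgroup (M_den C K X) ((Hom C X (c\<Omega> K))\<lparr>carrier := M_num C K X\<rparr>)"
  using M_den_subgroup M_num_subgroup K X
  by (intro group.subgroup_incl hom_group) (auto simp: M_den_def intro: cospansD)

text \<open>\<open>eps K X\<close> is composition with \<open>c\<gamma> K\<close> onto the
  numerator, followed by the quotient map. Its values before the quotient lie in the numerator
  anyway, so vanishing modulo \<open>M_den\<close> means lying in the image of
  \<open>c\<rho> K\<close>, that is, being a syzygy. Together with \<open>fmor_M_eps\<close> these
  facts keep most later arguments free of cosets.\<close>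

lemma comm_group_M: "comm_group (fobj (M K) X)"
  and eps_hom: "eps K X \<in> hom (Hom C X (cA K)) (fobj (M K) X)"
  and eps_surj: "eps K X ` carrier (Hom C X (cA K)) = carrier (fobj (M K) X)"
  and eps_eq_one_iff: "x \<in> carrier (Hom C X (cA K)) \<Longrightarrow>
      eps K X x = \<one>\<^bsub>fobj (M K) X\<^esub> \<longleftrightarrow> (X, x) \<in> Syz C K"
proof -
  let ?N = "(Hom C X (c\<Omega> K))\<lparr>carrier := M_num C K X\<rparr>"
  let ?g = "\<lambda>x. Comp C X (cA K) (c\<Omega> K) x (c\<gamma> K)"
  note Mod = comm_group.comm_group_image_Mod[OF comm_group_M_num M_den_subgroup_M_num inj_e,
      unfolded r_coset_consistent]
  have M: "fobj (M K) X = image_group e (?N Mod M_den C K X)"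
    by (simp add: M_obj_def)
  have eps: "eps K X = (\<lambda>x. e (M_den C K X #>\<^bsub>Hom C X (c\<Omega> K)\<^esub> x)) \<circ> ?g"
    by (auto simp: M_eps_def)
  have g: "?g \<in> hom (Hom C X (cA K)) ?N" "?g ` carrier (Hom C X (cA K)) = carrier ?N"
    using K X by (auto simp: hom_def M_num_def rep_image_def comp_add_left cospansD)
  show "comm_group (fobj (M K) X)"
    unfolding M by (rule Mod)
  show "eps K X \<in> hom (Hom C X (cA K)) (fobj (M K) X)"
    unfolding M eps by (rule hom_compose[OF g(1) Mod(2)])
  show "eps K X ` carrier (Hom C X (cA K)) = carrier (fobj (M K) X)"
    unfolding M eps image_comp[symmetric] g(2) by (rule Mod(3))
  assume x: "x \<in> carrier (Hom C X (cA K))"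
  then have "?g x \<in> carrier ?N"
    using g(2) by blast
  from Mod(4)[OF this] show "eps K X x = \<one>\<^bsub>fobj (M K) X\<^esub> \<longleftrightarrow> (X, x) \<in> Syz C K"
    using x X \<open>?g x \<in> carrier ?N\<close> by (simp add: M M_eps_def Syz_iff M_den_def)
qed

lemma eps_eq_iff:
  assumes "x \<in> carrier (Hom C X (cA K))" "y \<in> carrier (Hom C X (cA K))"
  shows "eps K X x = eps K X y \<longleftrightarrow> (X, x \<otimes>\<^bsub>Hom C X (cA K)\<^esub> inv\<^bsub>Hom C X (cA K)\<^esub> y) \<in> Syz C K"
proof -
  interpret group "Hom C X (cA K)"
    using K X by (intro hom_group cospansD)
  show ?thesis
    using assms K X eps_eq_one_iff hom_eq_iff_kernel[OF hom_comm_group comm_group_M eps_hom]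
    by (simp add: cospansD)
qed

end

text \<open>The action in \<open>M_obj\<close> is a union over all members \<open>y\<close> of a
  coset. It is a single coset because the part for each \<open>y\<close> equals the part for
  \<open>?g\<close>.\<close>

lemma fmor_M_eps:
  assumes K: "K \<in> cospans C" and X: "X \<in> Obj C"
    and "Y \<in> Obj C" "f \<in> carrier (Hom C Y X)" "x \<in> carrier (Hom C X (cA K))"
  shows "fmor (M K) X Y f (eps K X x) = eps K Y (Comp C Y X (cA K) f x)"
proof -
  note Kc = cospansD[OF K]
  let ?g = "Comp C X (cA K) (c\<Omega> K) x (c\<gamma> K)" and ?D = "\<lambda>X. M_den C K X" and ?H = "\<lambda>X. Hom C X (c\<Omega> K)"
  let ?U = "?D X #>\<^bsub>?H X\<^esub> ?g"
  have g: "?g \<in> carrier (?H X)"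
    using assms X Kc by (simp add: comp_closed)
  have coset: "?D Y #>\<^bsub>?H Y\<^esub> Comp C Y X (c\<Omega> K) f y = ?D Y #>\<^bsub>?H Y\<^esub> Comp C Y X (c\<Omega> K) f ?g"
    if "y \<in> ?U" for y
  proof -
    obtain d where d: "d \<in> ?D X" "y = d \<otimes>\<^bsub>?H X\<^esub> ?g"
      using \<open>y \<in> ?U\<close> by (auto simp: r_coset_def)
    then have dX: "d \<in> carrier (?H X)"
      using subgroup.mem_carrier[OF M_den_subgroup[OF K X]] by blast
    \<comment> \<open>Denominators are stable under precomposition, so the contribution of
      \<open>d\<close> is absorbed by the coset over \<open>Y\<close>.\<close>
    have fd: "Comp C Y X (c\<Omega> K) f d \<in> ?D Y"
      using d(1) assms(3,4) X Kc by (simp add: M_den_def M_num_def rep_image_precomp)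
    have fy: "Comp C Y X (c\<Omega> K) f y = Comp C Y X (c\<Omega> K) f d \<otimes>\<^bsub>?H Y\<^esub> Comp C Y X (c\<Omega> K) f ?g"
      using d dX g assms X Kc by (simp add: comp_add_right)
    interpret Y: comm_group "?H Y"
      using assms Kc by (intro hom_comm_group)
    note D = M_den_subgroup[OF K \<open>Y \<in> Obj C\<close>]
    have "?D Y #>\<^bsub>?H Y\<^esub> Comp C Y X (c\<Omega> K) f d = ?D Y"
      using fd D by (intro Y.coset_join2) (auto simp: subgroup.mem_carrier)
    then show ?thesis
      using Y.coset_mult_assoc[OF subgroup.subset[OF D] subgroup.mem_carrier[OF D fd],
          of "Comp C Y X (c\<Omega> K) f ?g"] g assms X Kc fy
      by (simp add: comp_closed)
  qed
  have "?g \<in> ?U"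
    using g M_den_subgroup[OF K X] X Kc by (intro group.rcos_self hom_group)
  then have "(\<Union>y\<in>?U. ?D Y #>\<^bsub>?H Y\<^esub> Comp C Y X (c\<Omega> K) f y) = ?D Y #>\<^bsub>?H Y\<^esub> Comp C Y X (c\<Omega> K) f ?g"
    using coset by blast
  moreover have "?U \<in> carrier ((?H X)\<lparr>carrier := M_num C K X\<rparr> Mod ?D X)"
    using assms(5) by (auto simp: FactGroup_def RCOSETS_def M_num_def rep_image_def)
  ultimately show ?thesis
    using assms X Kc by (simp add: M_obj_def M_eps_def the_inv_f_f[OF inj_e] comp_assoc)
qed

end

section \<open>The functor on the quotient category\<close>

lemma op_category_simps [simp]:
  "Obj (op_category P) = Obj P"
  "Hom (op_category P) X Y = Hom P Y X"
  "Comp (op_category P) X Y Z f g = Comp P Z Y X g f"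
  "Ide (op_category P) = Ide P"
  by (simp_all add: op_category_def)

context cospan_modules
begin

lemma eps_mult:
  assumes "K \<in> cospans C" "X \<in> Obj C" "x \<in> carrier (Hom C X (cA K))" "y \<in> carrier (Hom C X (cA K))"
  shows "eps K X (x \<otimes>\<^bsub>Hom C X (cA K)\<^esub> y) = eps K X x \<otimes>\<^bsub>fobj (M K) X\<^esub> eps K X y"
  using assms by (intro hom_mult[OF eps_hom])

lemma eps_closed:
  assumes "K \<in> cospans C" "X \<in> Obj C" "x \<in> carrier (Hom C X (cA K))"
  shows "eps K X x \<in> carrier (fobj (M K) X)"
  using assms by (intro hom_in_carrier[OF eps_hom])

lemma M_elemE:
  assumes "K \<in> cospans C" "X \<in> Obj C" "u \<in> carrier (fobj (M K) X)"
  obtains x where "x \<in> carrier (Hom C X (cA K))" "u = eps K X x"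
  using assms eps_surj[of K X] by (metis imageE)

text \<open>Both sides are the value of \<open>fmor (M K) X Y f\<close> at the same element.\<close>

lemma eps_precomp_cong:
  assumes "K \<in> cospans C" "X \<in> Obj C" "Y \<in> Obj C" "f \<in> carrier (Hom C Y X)"
    "x \<in> carrier (Hom C X (cA K))" "y \<in> carrier (Hom C X (cA K))" "eps K X x = eps K X y"
  shows "eps K Y (Comp C Y X (cA K) f x) = eps K Y (Comp C Y X (cA K) f y)"
  using assms by (metis fmor_M_eps)

lemma fmor_M_closed:
  assumes K: "K \<in> cospans C" and X: "X \<in> Obj C" and Y: "Y \<in> Obj C" and f: "f \<in> carrier (Hom C Y X)"
  shows "fmor (M K) X Y f \<in> hom (fobj (M K) X) (fobj (M K) Y) \<inter> extensional (carrier (fobj (M K) X))"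
proof
  show "fmor (M K) X Y f \<in> extensional (carrier (fobj (M K) X))"
    by (simp add: M_obj_def image_group_carrier)
  show "fmor (M K) X Y f \<in> hom (fobj (M K) X) (fobj (M K) Y)"
  proof (rule homI)
    fix u assume "u \<in> carrier (fobj (M K) X)"
    then show "fmor (M K) X Y f u \<in> carrier (fobj (M K) Y)"
      using assms by (elim M_elemE[OF K X]) (simp add: fmor_M_eps eps_closed comp_closed cospansD)
  next
    fix u v assume "u \<in> carrier (fobj (M K) X)" "v \<in> carrier (fobj (M K) X)"
    then obtain x y where "x \<in> carrier (Hom C X (cA K))" "u = eps K X x"
      "y \<in> carrier (Hom C X (cA K))" "v = eps K X y"
      by (metis M_elemE[OF K X])
    moreover have "monoid (Hom C X (cA K))"
      using K X by (intro group.is_monoid hom_group cospansD)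
    ultimately show "fmor (M K) X Y f (u \<otimes>\<^bsub>fobj (M K) X\<^esub> v)
        = fmor (M K) X Y f u \<otimes>\<^bsub>fobj (M K) Y\<^esub> fmor (M K) X Y f v"
      using assms
      by (simp add: eps_mult[symmetric] fmor_M_eps comp_add_right comp_closed cospansD monoid.m_closed)
  qed
qed

lemma M_ext:
  assumes "K \<in> cospans C" "X \<in> Obj C"
    and "u \<in> extensional (carrier (fobj (M K) X))" "v \<in> extensional (carrier (fobj (M K) X))"
    and "\<And>x. x \<in> carrier (Hom C X (cA K)) \<Longrightarrow> u (eps K X x) = v (eps K X x)"
  shows "u = v"
  using assms by (intro extensionalityI[of u "carrier (fobj (M K) X)"]) (auto elim: M_elemE)

text \<open>Since \<open>eps\<close> is onto, each functor law need only be checked on elements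
  \<open>eps K X x\<close>, where it reduces to a law of composition in P.\<close>

lemma additive_functor_M:
  assumes K: "K \<in> cospans C"
  shows "additive_functor (op_category C) Ab (M K)"
proof (intro additive_functor.intro preadditive_op_category preadditive_Ab additive_functor_axioms.intro)
  note closed = fmor_M_closed[OF K, THEN IntD1] fmor_M_closed[OF K, THEN IntD2]
  show "fobj (M K) X \<in> Obj Ab" if "X \<in> Obj (op_category C)" for X
    using comm_group_M[OF K] that by (simp add: Ab_def)
  show "fmor (M K) X Y \<in> hom (Hom (op_category C) X Y) (Hom Ab (fobj (M K) X) (fobj (M K) Y))"
    if "X \<in> Obj (op_category C)" "Y \<in> Obj (op_category C)" for X Y
  proof (rule homI)
    fix f assume "f \<in> carrier (Hom (op_category C) X Y)"
    then show "fmor (M K) X Y f \<in> carrier (Hom Ab (fobj (M K) X) (fobj (M K) Y))"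
      using that closed by (simp add: Ab_def)
  next
    fix f g assume fg: "f \<in> carrier (Hom (op_category C) X Y)" "g \<in> carrier (Hom (op_category C) X Y)"
    have "monoid (Hom C Y X)"
      using that by (intro group.is_monoid hom_group) simp_all
    then show "fmor (M K) X Y (f \<otimes>\<^bsub>Hom (op_category C) X Y\<^esub> g)
        = fmor (M K) X Y f \<otimes>\<^bsub>Hom Ab (fobj (M K) X) (fobj (M K) Y)\<^esub> fmor (M K) X Y g"
      using that fg K closed(2)[of X Y]
      by (intro M_ext[OF K, of X])
        (simp_all add: Ab_def monoid.m_closed fmor_M_eps comp_add_left eps_mult eps_closed comp_closed cospansD)
  qed
  show "fmor (M K) X Z (Comp (op_category C) X Y Z f g)
      = Comp Ab (fobj (M K) X) (fobj (M K) Y) (fobj (M K) Z) (fmor (M K) X Y f) (fmor (M K) Y Z g)"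
    if "X \<in> Obj (op_category C)" "Y \<in> Obj (op_category C)" "Z \<in> Obj (op_category C)"
      "f \<in> carrier (Hom (op_category C) X Y)" "g \<in> carrier (Hom (op_category C) Y Z)" for X Y Z f g
    using that K closed(2)[of X Z]
    by (intro M_ext[OF K, of X])
      (simp_all add: Ab_def compose_def fmor_M_eps comp_closed comp_assoc eps_closed cospansD)
  show "fmor (M K) X X (Ide (op_category C) X) = Ide Ab (fobj (M K) X)"
    if "X \<in> Obj (op_category C)" for X
    using that K closed(2)[of X X]
    by (intro M_ext[OF K, of X]) (simp_all add: Ab_def fmor_M_eps ide_closed ide_comp eps_closed cospansD)
qed

lemma Mod_cat_simps [simp]:
  "Obj (Mod_cat C) = {F. additive_functor (op_category C) Ab F}"
  "carrier (Hom (Mod_cat C) F G) = nat_trans (op_category C) Ab F G"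
  "Comp (Mod_cat C) F G H \<eta> \<theta> = (\<lambda>X\<in>Obj C. \<lambda>x\<in>carrier (fobj F X). \<theta> X (\<eta> X x))"
  "Ide (Mod_cat C) F = (\<lambda>X\<in>Obj C. \<lambda>x\<in>carrier (fobj F X). x)"
  "\<eta> \<otimes>\<^bsub>Hom (Mod_cat C) F G\<^esub> \<theta> = (\<lambda>X\<in>Obj C. \<lambda>x\<in>carrier (fobj F X). \<eta> X x \<otimes>\<^bsub>fobj G X\<^esub> \<theta> X x)"
  by (simp_all add: Mod_cat_def Comp_functor_category_Ab) (simp_all add: functor_category_def Ab_def)

lemma preadditive_Mod_cat: "preadditive_category (Mod_cat C :: (('o, 'm, 'u) pmodule, _) category)"
  unfolding Mod_cat_def by (rule preadditive_category.preadditive_functor_category[OF preadditive_Ab])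

lemma nat_trans_M_eqI:
  assumes K: "K \<in> cospans C" and T: "additive_functor (op_category C) Ab T"
    and "\<eta> \<in> nat_trans (op_category C) Ab (M K) T" "\<theta> \<in> nat_trans (op_category C) Ab (M K) T"
    and "\<And>X x. X \<in> Obj C \<Longrightarrow> x \<in> carrier (Hom C X (cA K)) \<Longrightarrow> \<eta> X (eps K X x) = \<theta> X (eps K X x)"
  shows "\<eta> = \<theta>"
proof (rule extensionalityI[of _ "Obj C"])
  show "\<eta> X = \<theta> X" if "X \<in> Obj C" for X
    using that assms by (intro M_ext[OF K]) (auto simp: nat_trans_Ab_iff[OF additive_functor_M T])
qed (use assms in \<open>auto simp: nat_trans_Ab_iff[OF additive_functor_M T]\<close>)

context
  fixes K L \<alpha>
  assumes K: "K \<in> cospans C" and L: "L \<in> cospans C" and a: "\<alpha> \<in> carrier (Hom (Aux C) K L)"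
begin

text \<open>The \<open>THE\<close> in \<open>M_mor\<close> is justified by descent along
  \<open>eps K\<close>: its kernel consists of the syzygies of \<open>K\<close>, which
  \<open>\<alpha>\<close> carries into the kernel of \<open>eps L\<close>.\<close>

lemma M_mor_nat: "M_mor C e K L \<alpha> \<in> nat_trans (op_category C) Ab (M K) (M L)"
  and M_mor_eps: "\<And>X x. X \<in> Obj C \<Longrightarrow> x \<in> carrier (Hom C X (cA K)) \<Longrightarrow>
    M_mor C e K L \<alpha> X (eps K X x) = eps L X (Comp C X (cA K) (cA L) x \<alpha>)"
proof -
  have "\<exists>!\<mu>. \<mu> \<in> nat_trans (op_category C) Ab (M K) (M L) \<and>
      (\<forall>X\<in>Obj (op_category C). \<forall>x\<in>carrier (Hom C X (cA K)).
        \<mu> X (eps K X x) = eps L X (Comp C X (cA K) (cA L) x \<alpha>))"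
  proof (rule ex1_nat_trans_descent[OF additive_functor_M[OF K] additive_functor_M[OF L],
        where act = "\<lambda>X Y f x. Comp C Y X (cA K) f x"])
    fix X assume "X \<in> Obj (op_category C)"
    then have "eps L X \<circ> (\<lambda>x. Comp C X (cA K) (cA L) x \<alpha>) \<in> hom (Hom C X (cA K)) (fobj (M L) X)"
      using K L Hom_AuxD[OF a] by (intro hom_compose[OF postcomp_hom eps_hom]) (simp_all add: cospansD)
    then show "(\<lambda>x. eps L X (Comp C X (cA K) (cA L) x \<alpha>)) \<in> hom (Hom C X (cA K)) (fobj (M L) X)"
      by (simp add: o_def)
  next
    fix X x assume "X \<in> Obj (op_category C)" "x \<in> carrier (Hom C X (cA K))" "eps K X x = \<one>\<^bsub>fobj (M K) X\<^esub>"
    then show "eps L X (Comp C X (cA K) (cA L) x \<alpha>) = \<one>\<^bsub>fobj (M L) X\<^esub>"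
      using a K L by (simp add: eps_eq_one_iff Hom_Aux_iff comp_closed cospansD)
  qed (use K L Hom_AuxD[OF a] in
      \<open>simp_all add: hom_comm_group eps_hom eps_surj fmor_M_eps comp_closed comp_assoc cospansD\<close>)
  from theI'[OF this] show "M_mor C e K L \<alpha> \<in> nat_trans (op_category C) Ab (M K) (M L)"
    and "\<And>X x. X \<in> Obj C \<Longrightarrow> x \<in> carrier (Hom C X (cA K)) \<Longrightarrow>
      M_mor C e K L \<alpha> X (eps K X x) = eps L X (Comp C X (cA K) (cA L) x \<alpha>)"
    by (simp_all add: M_mor_def)
qed

lemma M_mor_eqI:
  assumes "\<mu> \<in> nat_trans (op_category C) Ab (M K) (M L)"
    and "\<And>X x. X \<in> Obj C \<Longrightarrow> x \<in> carrier (Hom C X (cA K)) \<Longrightarrow>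
      \<mu> X (eps K X x) = eps L X (Comp C X (cA K) (cA L) x \<alpha>)"
  shows "M_mor C e K L \<alpha> = \<mu>"
  using assms by (intro nat_trans_M_eqI[OF K additive_functor_M[OF L] M_mor_nat]) (simp_all add: M_mor_eps)

lemma eps_postcomp_cong:
  assumes "X \<in> Obj C" "x \<in> carrier (Hom C X (cA K))" "y \<in> carrier (Hom C X (cA K))" "eps K X x = eps K X y"
  shows "eps L X (Comp C X (cA K) (cA L) x \<alpha>) = eps L X (Comp C X (cA K) (cA L) y \<alpha>)"
  using assms by (metis M_mor_eps)

end

lemma M_functor_simps [simp]:
  "fobj (M_functor C e) = M"
  "fmor (M_functor C e) = M_mor C e"
  by (simp_all add: M_functor_def)

text \<open>Each functor law is an instance of the uniqueness in \<open>M_mor_eqI\<close>. That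
  sums, composites and identities are natural, as this requires, comes from \<open>Mod_cat C\<close>
  being preadditive.\<close>

lemma additive_functor_M_functor: "additive_functor (Aux C) (Mod_cat C) (M_functor C e)"
proof (intro additive_functor.intro preadditive_Aux preadditive_Mod_cat additive_functor_axioms.intro)
  interpret Aux: preadditive_category "Aux C" by (rule preadditive_Aux)
  interpret Mod: preadditive_category "Mod_cat C :: (('o, 'm, 'u) pmodule, _) category" by (rule preadditive_Mod_cat)
  have obj: "M K \<in> Obj (Mod_cat C)" if "K \<in> cospans C" for K
    using that by (simp add: additive_functor_M)
  then show "fobj (M_functor C e) K \<in> Obj (Mod_cat C)" if "K \<in> Obj (Aux C)" for K
    using that by simp
  show "fmor (M_functor C e) K L \<in> hom (Hom (Aux C) K L)
      (Hom (Mod_cat C) (fobj (M_functor C e) K) (fobj (M_functor C e) L))"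
    if "K \<in> Obj (Aux C)" "L \<in> Obj (Aux C)" for K L
  proof (rule homI)
    fix \<alpha> assume "\<alpha> \<in> carrier (Hom (Aux C) K L)"
    then show "fmor (M_functor C e) K L \<alpha>
        \<in> carrier (Hom (Mod_cat C) (fobj (M_functor C e) K) (fobj (M_functor C e) L))"
      using that by (simp add: M_mor_nat)
  next
    fix \<alpha> \<beta> assume ab: "\<alpha> \<in> carrier (Hom (Aux C) K L)" "\<beta> \<in> carrier (Hom (Aux C) K L)"
    have KL: "K \<in> cospans C" "L \<in> cospans C" using that by simp_all
    have "monoid (Hom (Aux C) K L)"
      using that by (intro group.is_monoid Aux.hom_group)
    then have abc: "\<alpha> \<otimes>\<^bsub>Hom (Aux C) K L\<^esub> \<beta> \<in> carrier (Hom (Aux C) K L)"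
      using ab by (rule monoid.m_closed)
    have "monoid (Hom (Mod_cat C) (M K) (M L))"
      using obj[OF KL(1)] obj[OF KL(2)] by (intro group.is_monoid Mod.hom_group)
    then have "M_mor C e K L \<alpha> \<otimes>\<^bsub>Hom (Mod_cat C) (M K) (M L)\<^esub> M_mor C e K L \<beta>
        \<in> carrier (Hom (Mod_cat C) (M K) (M L))"
      using ab KL by (intro monoid.m_closed) (simp_all add: M_mor_nat)
    then have "M_mor C e K L (\<alpha> \<otimes>\<^bsub>Hom (Aux C) K L\<^esub> \<beta>)
        = M_mor C e K L \<alpha> \<otimes>\<^bsub>Hom (Mod_cat C) (M K) (M L)\<^esub> M_mor C e K L \<beta>"
      using KL ab Hom_AuxD[OF ab(1)] Hom_AuxD[OF ab(2)]
      by (intro M_mor_eqI[OF KL abc])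
        (simp_all add: M_mor_eps eps_closed comp_add_right eps_mult comp_closed cospansD)
    then show "fmor (M_functor C e) K L (\<alpha> \<otimes>\<^bsub>Hom (Aux C) K L\<^esub> \<beta>) = fmor (M_functor C e) K L \<alpha>
        \<otimes>\<^bsub>Hom (Mod_cat C) (fobj (M_functor C e) K) (fobj (M_functor C e) L)\<^esub> fmor (M_functor C e) K L \<beta>"
      by (simp only: M_functor_simps)
  qed
  show "fmor (M_functor C e) K N (Comp (Aux C) K L N \<alpha> \<beta>)
      = Comp (Mod_cat C) (fobj (M_functor C e) K) (fobj (M_functor C e) L) (fobj (M_functor C e) N)
          (fmor (M_functor C e) K L \<alpha>) (fmor (M_functor C e) L N \<beta>)"
    if KLN: "K \<in> Obj (Aux C)" "L \<in> Obj (Aux C)" "N \<in> Obj (Aux C)"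
      and ab: "\<alpha> \<in> carrier (Hom (Aux C) K L)" "\<beta> \<in> carrier (Hom (Aux C) L N)" for K L N \<alpha> \<beta>
  proof -
    have "Comp (Mod_cat C) (M K) (M L) (M N) (M_mor C e K L \<alpha>) (M_mor C e L N \<beta>)
        \<in> carrier (Hom (Mod_cat C) (M K) (M N))"
      using KLN ab by (intro Mod.comp_closed obj) (simp_all add: M_mor_nat)
    then have "M_mor C e K N (Comp (Aux C) K L N \<alpha> \<beta>)
        = Comp (Mod_cat C) (M K) (M L) (M N) (M_mor C e K L \<alpha>) (M_mor C e L N \<beta>)"
      using KLN ab Hom_AuxD[OF ab(1)] Hom_AuxD[OF ab(2)] Aux.comp_closed[OF KLN ab]
      by (intro M_mor_eqI) (simp_all add: M_mor_eps eps_closed comp_assoc comp_closed cospansD)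
    then show ?thesis
      by (simp only: M_functor_simps)
  qed
  show "fmor (M_functor C e) K K (Ide (Aux C) K) = Ide (Mod_cat C) (fobj (M_functor C e) K)"
    if K: "K \<in> Obj (Aux C)" for K
  proof -
    have "Ide (Mod_cat C) (M K) \<in> carrier (Hom (Mod_cat C) (M K) (M K))"
      using K by (intro Mod.ide_closed obj) simp
    then have "M_mor C e K K (Ide (Aux C) K) = Ide (Mod_cat C) (M K)"
      using K Aux.ide_closed[OF K] by (intro M_mor_eqI) (simp_all add: eps_closed comp_ide cospansD)
    then show ?thesis
      by (simp only: M_functor_simps)
  qed
qed

end

section \<open>The cospan with adjoined relations\<close>

context preadditive_category
begin

text \<open>A witness into \<open>S\<close> amounts to a pair: its \<open>p\<close>-component is a
  combination \<omega> of the relations of \<open>L\<close>, its \<open>q\<close>-component a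
  coefficient x. The syzygy equation of \<open>N\<close> then reads y\<gamma> = \<omega>\<rho> +
  x\<alpha>\<gamma>, which says that y - x\<alpha> is a syzygy of \<open>L\<close>.\<close>

lemma ex_cokernel_cospan:
  assumes K: "K \<in> cospans C" and L: "L \<in> cospans C" and \<alpha>: "\<alpha> \<in> carrier (Hom C (cA K) (cA L))"
    and biproduct: "is_biproduct C (cR L) (cA K) S i j p q"
  obtains N where "N \<in> cospans C" "cA N = cA L"
    "\<And>X y. (X, y) \<in> Syz C N \<longleftrightarrow> X \<in> Obj C \<and> y \<in> carrier (Hom C X (cA L)) \<and>
      (\<exists>x\<in>carrier (Hom C X (cA K)). (X, y \<otimes>\<^bsub>Hom C X (cA L)\<^esub>
         inv\<^bsub>Hom C X (cA L)\<^esub> Comp C X (cA K) (cA L) x \<alpha>) \<in> Syz C L)"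
proof -
  let ?A = "cA K" and ?B = "cA L" and ?R = "cR L" and ?W = "c\<Omega> L"
  let ?g = "Comp C ?A ?B ?W \<alpha> (c\<gamma> L)"
  have S: "S \<in> Obj C" "i \<in> carrier (Hom C ?R S)" "j \<in> carrier (Hom C ?A S)"
    "p \<in> carrier (Hom C S ?R)" "q \<in> carrier (Hom C S ?A)"
    "Comp C ?R S ?R i p = Ide C ?R" "Comp C ?A S ?A j q = Ide C ?A"
    "Comp C ?R S ?A i q = \<one>\<^bsub>Hom C ?R ?A\<^esub>" "Comp C ?A S ?R j p = \<one>\<^bsub>Hom C ?A ?R\<^esub>"
    using biproduct by (simp_all add: is_biproduct_def)
  note closed = S(1-5) \<alpha> cospansD[OF K] cospansD[OF L] comp_closed
  \<comment> \<open>The copairing of \<open>c\<rho> L\<close> and \<open>?g\<close>, written out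
    with the projections of the biproduct.\<close>
  define r where "r = Comp C S ?R ?W p (c\<rho> L) \<otimes>\<^bsub>Hom C S ?W\<^esub> Comp C S ?A ?W q ?g"
  have SW: "monoid (Hom C S ?W)"
    by (intro group.is_monoid hom_group closed)
  have r: "r \<in> carrier (Hom C S ?W)"
    unfolding r_def by (intro monoid.m_closed[OF SW] closed)
  define N where "N = \<lparr>cA = ?B, c\<Omega> = ?W, cR = S, c\<gamma> = c\<gamma> L, c\<rho> = r\<rparr>"
  have N: "N \<in> cospans C"
    using closed r by (simp add: cospans_def N_def)
  have comp_r: "Comp C X S ?W \<omega> r = Comp C X ?R ?W (Comp C X S ?R \<omega> p) (c\<rho> L)
      \<otimes>\<^bsub>Hom C X ?W\<^esub> Comp C X ?B ?W (Comp C X ?A ?B (Comp C X S ?A \<omega> q) \<alpha>) (c\<gamma> L)"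
    if "X \<in> Obj C" "\<omega> \<in> carrier (Hom C X S)" for X \<omega>
    using that by (simp add: r_def closed comp_add_right comp_assoc)
  have "(X, y) \<in> Syz C N \<longleftrightarrow> X \<in> Obj C \<and> y \<in> carrier (Hom C X ?B) \<and>
      (\<exists>x\<in>carrier (Hom C X ?A). (X, y \<otimes>\<^bsub>Hom C X ?B\<^esub>
         inv\<^bsub>Hom C X ?B\<^esub> Comp C X ?A ?B x \<alpha>) \<in> Syz C L)" (is "?l \<longleftrightarrow> ?r") for X y
  proof (cases "X \<in> Obj C \<and> y \<in> carrier (Hom C X ?B)")
    case True
    then have X: "X \<in> Obj C" and y: "y \<in> carrier (Hom C X ?B)" by auto
    interpret XB: comm_group "Hom C X ?B" using X by (intro hom_comm_group closed)
    interpret XW: comm_group "Hom C X ?W" using X by (intro hom_comm_group closed)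
    \<comment> \<open>Bilinearity moves the term with \<open>x\<close> to the other side, which
      gives the right-hand side the shape of \<open>comp_r\<close>.\<close>
    have iff: "(X, y \<otimes>\<^bsub>Hom C X ?B\<^esub> inv\<^bsub>Hom C X ?B\<^esub> Comp C X ?A ?B x \<alpha>) \<in> Syz C L \<longleftrightarrow>
       (\<exists>\<omega>\<in>carrier (Hom C X ?R). Comp C X ?B ?W y (c\<gamma> L)
          = Comp C X ?R ?W \<omega> (c\<rho> L) \<otimes>\<^bsub>Hom C X ?W\<^esub> Comp C X ?B ?W (Comp C X ?A ?B x \<alpha>) (c\<gamma> L))"
      if x: "x \<in> carrier (Hom C X ?A)" for x
    proof -
      have "Comp C X ?B ?W (y \<otimes>\<^bsub>Hom C X ?B\<^esub> inv\<^bsub>Hom C X ?B\<^esub> Comp C X ?A ?B x \<alpha>) (c\<gamma> L)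
          = Comp C X ?B ?W y (c\<gamma> L) \<otimes>\<^bsub>Hom C X ?W\<^esub>
            inv\<^bsub>Hom C X ?W\<^esub> Comp C X ?B ?W (Comp C X ?A ?B x \<alpha>) (c\<gamma> L)"
        using X y x by (simp add: closed comp_add_left comp_inv_left)
      moreover have "a \<otimes>\<^bsub>Hom C X ?W\<^esub> inv\<^bsub>Hom C X ?W\<^esub> c = b \<longleftrightarrow> a = b \<otimes>\<^bsub>Hom C X ?W\<^esub> c"
        if "a \<in> carrier (Hom C X ?W)" "b \<in> carrier (Hom C X ?W)" "c \<in> carrier (Hom C X ?W)" for a b c
        using that XW.inv_solve_right[of b a c] by auto
      ultimately show ?thesis
        using X y x by (simp add: Syz_def closed)
    qed
    show ?thesis
    proof
      assume ?l
      then obtain \<omega> where w: "\<omega> \<in> carrier (Hom C X S)" "Comp C X ?B ?W y (c\<gamma> L) = Comp C X S ?W \<omega> r"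
        by (auto simp: Syz_def N_def)
      then have "(X, y \<otimes>\<^bsub>Hom C X ?B\<^esub> inv\<^bsub>Hom C X ?B\<^esub> Comp C X ?A ?B (Comp C X S ?A \<omega> q) \<alpha>) \<in> Syz C L"
        using X by (subst iff) (auto simp: closed comp_r)
      then show ?r
        using X y w by (auto simp: closed)
    next
      assume ?r
      then obtain x \<omega> where x: "x \<in> carrier (Hom C X ?A)" and w: "\<omega> \<in> carrier (Hom C X ?R)"
        and eq: "Comp C X ?B ?W y (c\<gamma> L)
          = Comp C X ?R ?W \<omega> (c\<rho> L) \<otimes>\<^bsub>Hom C X ?W\<^esub> Comp C X ?B ?W (Comp C X ?A ?B x \<alpha>) (c\<gamma> L)"
        using iff by blast
      interpret XS: comm_group "Hom C X S" using X by (intro hom_comm_group closed)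
      interpret XR: comm_group "Hom C X ?R" using X by (intro hom_comm_group closed)
      interpret XA: comm_group "Hom C X ?A" using X by (intro hom_comm_group closed)
      \<comment> \<open>The pairing of \<open>\<omega>\<close> and \<open>x\<close>; the biproduct
        identities recover both components.\<close>
      let ?v = "Comp C X ?R S \<omega> i \<otimes>\<^bsub>Hom C X S\<^esub> Comp C X ?A S x j"
      have v: "?v \<in> carrier (Hom C X S)"
        using X x w by (simp add: closed)
      have "Comp C X S ?R ?v p = \<omega>" "Comp C X S ?A ?v q = x"
        using X x w by (simp_all add: closed comp_add_left comp_assoc S comp_ide comp_zero)
      then have "Comp C X ?B ?W y (c\<gamma> L) = Comp C X S ?W ?v r"
        using X v eq by (simp add: comp_r)
      then show ?l
        using X y v by (auto simp: Syz_def N_def)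
    qed
  qed (auto simp: Syz_def N_def)
  then show thesis
    by (intro that[OF N]) (simp_all add: N_def)
qed

end

section \<open>Faithfulness, fullness and monomorphisms\<close>

sublocale cospan_modules \<subseteq> Q: category_ideal "Aux C" "I_ideal C"
  by (rule category_ideal_I_ideal)

context cospan_modules
begin

text \<open>The difference lies in the ideal iff it is a syzygy over \<open>cA K\<close>, that is,
  iff \<open>eps L (cA K)\<close> kills it. Equality of morphisms in Q(P) thus becomes equality of
  elements of M(L).\<close>

lemma cls_eq_iff_eps:
  assumes "K \<in> cospans C" "L \<in> cospans C" "\<alpha> \<in> carrier (Hom (Aux C) K L)" "\<beta> \<in> carrier (Hom (Aux C) K L)"
  shows "Q.cls K L \<alpha> = Q.cls K L \<beta> \<longleftrightarrow> eps L (cA K) \<alpha> = eps L (cA K) \<beta>"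
proof -
  have "monoid (Hom (Aux C) K L)" "group (Hom (Aux C) K L)"
    using assms by (auto intro!: group.is_monoid Q.hom_group)
  then have "\<alpha> \<otimes>\<^bsub>Hom (Aux C) K L\<^esub> inv\<^bsub>Hom (Aux C) K L\<^esub> \<beta> \<in> carrier (Hom (Aux C) K L)"
    using assms by (intro monoid.m_closed group.inv_closed)
  then show ?thesis
    using assms by (simp add: Q.cls_eq_iff eps_eq_iff I_ideal_iff inv_Aux Hom_AuxD cospansD)
qed

text \<open>If \<open>\<alpha>\<close> is a syzygy of \<open>L\<close>, then so is every composite
  x\<alpha>, hence \<open>M_mor\<close> vanishes on all \<open>eps K X x\<close>.\<close>

lemma ideal_killing_functor_M: "ideal_killing_functor (Aux C) (I_ideal C) (Mod_cat C) (M_functor C e)"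
proof (intro ideal_killing_functor.intro category_ideal_I_ideal additive_functor_M_functor
    ideal_killing_functor_axioms.intro)
  interpret Mod: preadditive_category "Mod_cat C :: (('o, 'm, 'u) pmodule, _) category" by (rule preadditive_Mod_cat)
  fix K L \<alpha> assume KL: "K \<in> Obj (Aux C)" "L \<in> Obj (Aux C)" and a: "\<alpha> \<in> I_ideal C K L"
  have aux: "\<alpha> \<in> carrier (Hom (Aux C) K L)"
    using KL a by (simp add: I_ideal_iff)
  have one: "\<one>\<^bsub>Hom (Mod_cat C) (M K) (M L)\<^esub> = (\<lambda>X\<in>Obj C. \<lambda>x\<in>carrier (fobj (M K) X). \<one>\<^bsub>fobj (M L) X\<^esub>)"
    by (auto simp: Mod_cat_def functor_category_def Ab_def)
  have "\<one>\<^bsub>Hom (Mod_cat C) (M K) (M L)\<^esub> \<in> carrier (Hom (Mod_cat C) (M K) (M L))"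
    using KL by (intro Mod.one_closed_hom) (simp_all add: additive_functor_M)
  then have "M_mor C e K L \<alpha> = \<one>\<^bsub>Hom (Mod_cat C) (M K) (M L)\<^esub>"
  proof (intro M_mor_eqI)
    fix X x assume "X \<in> Obj C" "x \<in> carrier (Hom C X (cA K))"
    moreover from this have "eps L X (Comp C X (cA K) (cA L) x \<alpha>) = \<one>\<^bsub>fobj (M L) X\<^esub>"
      using KL a aux by (simp add: eps_eq_one_iff comp_closed cospansD Hom_AuxD I_ideal_iff Syz_precomp)
    ultimately show "\<one>\<^bsub>Hom (Mod_cat C) (M K) (M L)\<^esub> X (eps K X x) = eps L X (Comp C X (cA K) (cA L) x \<alpha>)"
      using KL by (simp add: one eps_closed)
  qed (use KL aux in simp_all)
  then show "fmor (M_functor C e) K L \<alpha>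
      = \<one>\<^bsub>Hom (Mod_cat C) (fobj (M_functor C e) K) (fobj (M_functor C e) L)\<^esub>"
    by simp
qed

sublocale Mbar: ideal_killing_functor "Aux C" "I_ideal C" "Mod_cat C" "M_functor C e"
  by (rule ideal_killing_functor_M)

lemma fmor_Mbar:
  "\<lbrakk>K \<in> cospans C; L \<in> cospans C; \<alpha> \<in> carrier (Hom (Aux C) K L)\<rbrakk>
    \<Longrightarrow> fmor Mbar.induced K L (Q.cls K L \<alpha>) = M_mor C e K L \<alpha>"
  by (subst Mbar.fmor_induced) simp_all

lemma faithful_Mbar: "faithful_functor (Q_cat C) (Mod_cat C) Mbar.induced"
  unfolding faithful_functor_def Q_cat_def
proof (intro ballI inj_onI)
  fix K L U V
  assume "K \<in> Obj (quotient_category (Aux C) (I_ideal C))" "L \<in> Obj (quotient_category (Aux C) (I_ideal C))"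
    and "U \<in> carrier (Hom (quotient_category (Aux C) (I_ideal C)) K L)"
      "V \<in> carrier (Hom (quotient_category (Aux C) (I_ideal C)) K L)"
    and eq: "fmor Mbar.induced K L U = fmor Mbar.induced K L V"
  then obtain \<alpha> \<beta> where KL: "K \<in> cospans C" "L \<in> cospans C" and U: "U = Q.cls K L \<alpha>" and V: "V = Q.cls K L \<beta>"
    and ab: "\<alpha> \<in> carrier (Hom (Aux C) K L)" "\<beta> \<in> carrier (Hom (Aux C) K L)"
    by (auto simp: Q.carrier_quotient)
  have "M_mor C e K L \<alpha> (cA K) (eps K (cA K) (Ide C (cA K)))
      = M_mor C e K L \<beta> (cA K) (eps K (cA K) (Ide C (cA K)))"
    using eq KL ab by (simp add: U V fmor_Mbar)
  then show "U = V"
    using KL ab by (simp add: U V cls_eq_iff_eps M_mor_eps ide_closed ide_comp cospansD Hom_AuxD)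
qed

lemma full_Mbar: "full_functor (Q_cat C) (Mod_cat C) Mbar.induced"
  unfolding full_functor_def Q_cat_def
proof (intro ballI equalityI subsetI)
  fix K L
  assume "K \<in> Obj (quotient_category (Aux C) (I_ideal C))" "L \<in> Obj (quotient_category (Aux C) (I_ideal C))"
  then have K: "K \<in> cospans C" and L: "L \<in> cospans C" by simp_all
  { fix \<mu> assume "\<mu> \<in> fmor Mbar.induced K L ` carrier (Hom (quotient_category (Aux C) (I_ideal C)) K L)"
    then show "\<mu> \<in> carrier (Hom (Mod_cat C) (fobj Mbar.induced K) (fobj Mbar.induced L))"
      using K L by (auto simp: Q.carrier_quotient fmor_Mbar M_mor_nat) }
  fix \<mu> assume "\<mu> \<in> carrier (Hom (Mod_cat C) (fobj Mbar.induced K) (fobj Mbar.induced L))"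
  then have mu: "\<mu> \<in> nat_trans (op_category C) Ab (M K) (M L)" by simp
  note mu' = mu[unfolded nat_trans_Ab_iff[OF additive_functor_M[OF K] additive_functor_M[OF L]]]
  have A: "cA K \<in> Obj C" "Ide C (cA K) \<in> carrier (Hom C (cA K) (cA K))"
    using K by (simp_all add: cospansD ide_closed)
  have "\<mu> (cA K) (eps K (cA K) (Ide C (cA K))) \<in> carrier (fobj (M L) (cA K))"
    using mu' A K by (auto intro!: hom_in_carrier[of "\<mu> (cA K)"] eps_closed)
  then obtain \<alpha> where a: "\<alpha> \<in> carrier (Hom C (cA K) (cA L))"
    "\<mu> (cA K) (eps K (cA K) (Ide C (cA K))) = eps L (cA K) \<alpha>"
    using A(1) L by (metis M_elemE)
  \<comment> \<open>The class of \<open>x\<close> is the restriction along \<open>x\<close> of the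
    class of the identity, so naturality forces the value of \<open>\<mu>\<close>.\<close>
  have mu_eps: "\<mu> X (eps K X x) = eps L X (Comp C X (cA K) (cA L) x \<alpha>)"
    if "X \<in> Obj C" "x \<in> carrier (Hom C X (cA K))" for X x
  proof -
    have "\<mu> X (eps K X x) = \<mu> X (fmor (M K) (cA K) X x (eps K (cA K) (Ide C (cA K))))"
      using that A K by (simp add: fmor_M_eps comp_ide)
    also have "\<dots> = fmor (M L) (cA K) X x (\<mu> (cA K) (eps K (cA K) (Ide C (cA K))))"
      using that A K mu' by (simp add: eps_closed)
    also have "\<dots> = eps L X (Comp C X (cA K) (cA L) x \<alpha>)"
      using that A K L a by (simp add: fmor_M_eps)
    finally show ?thesis .
  qed
  \<comment> \<open>A syzygy of \<open>K\<close> has trivial class and \<open>\<mu> X\<close>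
    preserves triviality, so by \<open>mu_eps\<close> its composite with \<open>\<alpha>\<close> is
    a syzygy of \<open>L\<close>; this is what makes \<open>\<alpha>\<close> a morphism of
    \<open>Aux C\<close>.\<close>
  have "\<mu> X \<one>\<^bsub>fobj (M K) X\<^esub> = \<one>\<^bsub>fobj (M L) X\<^esub>" if "X \<in> Obj C" for X
    using that mu' K L by (intro comm_group_hom_one comm_group_M) auto
  then have aux: "\<alpha> \<in> carrier (Hom (Aux C) K L)"
    using a(1) K L mu_eps eps_eq_one_iff[OF K] eps_eq_one_iff[OF L] comp_closed
    by (auto simp: Hom_Aux_iff cospansD dest: SyzD) (metis SyzD cospansD(1))
  have "\<mu> = fmor Mbar.induced K L (Q.cls K L \<alpha>)"
    using K L aux mu mu_eps by (simp add: fmor_Mbar M_mor_eqI)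
  with aux show "\<mu> \<in> fmor Mbar.induced K L ` carrier (Hom (quotient_category (Aux C) (I_ideal C)) K L)"
    by (auto simp: Q.carrier_quotient)
qed

text \<open>A monomorphism of \<open>Q(P)\<close> is tested on the cospans \<open>(X \<rightarrow> X \<leftarrow> X)\<close> with legs the
  identity and zero: their only syzygies are zero morphisms, so every \<open>X \<rightarrow> A\<^sub>K\<close> is a morphism to \<open>K\<close>.\<close>

lemma M_mor_inj_on_if_mono:
  assumes K: "K \<in> cospans C" and L: "L \<in> cospans C" and a: "\<alpha> \<in> carrier (Hom (Aux C) K L)"
    and mono: "is_mono (Q_cat C) K L (Q.cls K L \<alpha>)" and X: "X \<in> Obj C"
  shows "inj_on (M_mor C e K L \<alpha> X) (carrier (fobj (M K) X))"
proof (rule inj_onI)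
  define T where "T = \<lparr>cA = X, c\<Omega> = X, cR = X, c\<gamma> = Ide C X, c\<rho> = \<one>\<^bsub>Hom C X X\<^esub>\<rparr>"
  have T: "T \<in> cospans C" "cA T = X"
    using X by (simp_all add: T_def cospans_def ide_closed one_closed_hom)
  have Syz_T: "\<sigma> = \<one>\<^bsub>Hom C S X\<^esub>" if "(S, \<sigma>) \<in> Syz C T" for S \<sigma>
    using that X by (auto simp: Syz_def T_def comp_ide comp_zero)
  have aux: "x \<in> carrier (Hom (Aux C) T K)" if "x \<in> carrier (Hom C X (cA K))" for x
  proof -
    have "(S, Comp C S X (cA K) \<sigma> x) \<in> Syz C K" if "(S, \<sigma>) \<in> Syz C T" for S \<sigma>
      using that SyzD(1)[OF that] \<open>x \<in> _\<close> X K Syz_T[OF that] subgroup.one_closed[OF Syz_subgroup[OF K]]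
      by (simp add: zero_comp cospansD)
    with \<open>x \<in> _\<close> show ?thesis
      by (simp add: Hom_Aux_iff T(2))
  qed
  fix u v assume "u \<in> carrier (fobj (M K) X)" "v \<in> carrier (fobj (M K) X)"
    and eq: "M_mor C e K L \<alpha> X u = M_mor C e K L \<alpha> X v"
  then obtain x y where x: "x \<in> carrier (Hom C X (cA K))" "u = eps K X x"
    and y: "y \<in> carrier (Hom C X (cA K))" "v = eps K X y"
    by (metis M_elemE[OF K X])
  \<comment> \<open>Because \<open>cA T = X\<close>, equality under \<open>eps L X\<close> is
    equality of morphisms from \<open>T\<close> to \<open>L\<close> in Q(P), from which the
    monomorphism can be cancelled.\<close>
  have "Q.cls T L (Comp (Aux C) T K L x \<alpha>) = Q.cls T L (Comp (Aux C) T K L y \<alpha>)"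
    using eq x y aux[OF x(1)] aux[OF y(1)] K L X a T Q.comp_closed[of T K L _ \<alpha>]
    by (subst cls_eq_iff_eps) (simp_all add: M_mor_eps)
  then have "Comp (Q_cat C) T K L (Q.cls T K x) (Q.cls K L \<alpha>) = Comp (Q_cat C) T K L (Q.cls T K y) (Q.cls K L \<alpha>)"
    using x y aux K L a T unfolding Q_cat_def by (subst (1 2) Q.cls_comp) simp_all
  then have "Q.cls T K x = Q.cls T K y"
    using mono T aux[OF x(1)] aux[OF y(1)] unfolding is_mono_def Q_cat_def
    by (auto simp: Q.carrier_quotient)
  then show "u = v"
    using x y aux[OF x(1)] aux[OF y(1)] K T by (simp add: cls_eq_iff_eps)
qed

end

section \<open>Epimorphisms, cokernels and images\<close>

lemma is_epiD:
  "\<lbrakk>is_epi C A B f; T \<in> Obj C; u \<in> carrier (Hom C B T); v \<in> carrier (Hom C B T);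
    Comp C A B T f u = Comp C A B T f v\<rbrakk> \<Longrightarrow> u = v"
  by (simp add: is_epi_def)

text \<open>If qu = qv, then both \<open>u\<close> and \<open>v\<close> factor qv through the
  cokernel, and the factorization is unique.\<close>

lemma (in preadditive_category) is_epi_if_cokernel:
  assumes "A \<in> Obj C" "B \<in> Obj C" "f \<in> carrier (Hom C A B)" and coker: "is_cokernel C A B f K q"
  shows "is_epi C B K q"
proof -
  have K: "K \<in> Obj C" "q \<in> carrier (Hom C B K)" "Comp C A B K f q = \<one>\<^bsub>Hom C A K\<^esub>"
    using coker by (simp_all add: is_cokernel_def)
  have "u = v"
    if T: "T \<in> Obj C" and u: "u \<in> carrier (Hom C K T)" and v: "v \<in> carrier (Hom C K T)"
      and eq: "Comp C B K T q u = Comp C B K T q v" for T u v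
  proof -
    have "Comp C A B T f (Comp C B K T q v) = \<one>\<^bsub>Hom C A T\<^esub>"
      using assms K T v by (simp add: comp_assoc[symmetric] zero_comp)
    then have "\<exists>!w. w \<in> carrier (Hom C K T) \<and> Comp C B K T q w = Comp C B K T q v"
      using assms K T v comp_closed unfolding is_cokernel_def by blast
    then show "u = v"
      using u v eq by blast
  qed
  then show ?thesis
    using K by (simp add: is_epi_def)
qed

locale additive_cospan_modules = cospan_modules C e + additive_category C
  for C :: "('o, 'm) category" and e :: "'m set \<Rightarrow> 'u"
begin

text \<open>Seen through \<open>eps\<close>, the syzygies of \<open>N\<close> over \<open>X\<close>
  are the elements whose class lies in the image of M(\<alpha>) at \<open>X\<close>. The last two
  facts make the identity of \<open>cA L\<close> a morphism from \<open>L\<close> to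
  \<open>N\<close> whose composite with \<open>\<alpha>\<close> vanishes in Q(P).\<close>

lemma ex_cokernel_cospan_eps:
  assumes K: "K \<in> cospans C" and L: "L \<in> cospans C" and a: "\<alpha> \<in> carrier (Hom (Aux C) K L)"
  obtains N where "N \<in> cospans C" "cA N = cA L"
    "\<And>X y. X \<in> Obj C \<Longrightarrow> y \<in> carrier (Hom C X (cA L)) \<Longrightarrow> (X, y) \<in> Syz C N \<longleftrightarrow>
      (\<exists>x\<in>carrier (Hom C X (cA K)). eps L X y = eps L X (Comp C X (cA K) (cA L) x \<alpha>))"
    "Ide C (cA L) \<in> carrier (Hom (Aux C) L N)" "(cA K, \<alpha>) \<in> Syz C N"
proof -
  note KL = cospansD[OF K] cospansD[OF L] Hom_AuxD[OF a]
  obtain S i j p q where "is_biproduct C (cR L) (cA K) S i j p q"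
    using ex_biproduct KL by blast
  then obtain N where N: "N \<in> cospans C" "cA N = cA L"
    and Syz_N: "\<And>X y. (X, y) \<in> Syz C N \<longleftrightarrow> X \<in> Obj C \<and> y \<in> carrier (Hom C X (cA L)) \<and>
      (\<exists>x\<in>carrier (Hom C X (cA K)). (X, y \<otimes>\<^bsub>Hom C X (cA L)\<^esub>
         inv\<^bsub>Hom C X (cA L)\<^esub> Comp C X (cA K) (cA L) x \<alpha>) \<in> Syz C L)"
    using ex_cokernel_cospan[OF K L Hom_AuxD[OF a]] by metis
  have Syz_N': "(X, y) \<in> Syz C N \<longleftrightarrow>
      (\<exists>x\<in>carrier (Hom C X (cA K)). eps L X y = eps L X (Comp C X (cA K) (cA L) x \<alpha>))"
    if "X \<in> Obj C" "y \<in> carrier (Hom C X (cA L))" for X y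
    using that KL L by (simp add: Syz_N eps_eq_iff comp_closed)
  have "(X, y) \<in> Syz C N" if "(X, y) \<in> Syz C L" for X y
  proof -
    have X: "X \<in> Obj C" and y: "y \<in> carrier (Hom C X (cA L))"
      using SyzD[OF that] by simp_all
    have "eps L X y = \<one>\<^bsub>fobj (M L) X\<^esub>" "eps L X \<one>\<^bsub>Hom C X (cA L)\<^esub> = \<one>\<^bsub>fobj (M L) X\<^esub>"
      using that X y KL L subgroup.one_closed[OF Syz_subgroup[OF L X]]
      by (simp_all add: eps_eq_one_iff one_closed_hom)
    \<comment> \<open>A syzygy of \<open>L\<close> is obtained with coefficient zero.\<close>
    then have "eps L X y = eps L X (Comp C X (cA K) (cA L) \<one>\<^bsub>Hom C X (cA K)\<^esub> \<alpha>)"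
      using X KL by (simp add: zero_comp)
    then show ?thesis
      using X y KL by (auto simp: Syz_N' intro!: one_closed_hom)
  qed
  then have "Ide C (cA L) \<in> carrier (Hom (Aux C) L N)"
    using KL N by (auto simp: Hom_Aux_iff ide_closed comp_ide SyzD)
  \<comment> \<open>Here the coefficient is the identity of \<open>cA K\<close>.\<close>
  moreover have "(cA K, \<alpha>) \<in> Syz C N"
    using KL by (auto simp: Syz_N' ide_comp intro!: bexI[of _ "Ide C (cA K)"] ide_closed)
  ultimately show thesis
    using that[OF N Syz_N'] by blast
qed

lemma Q_simps [simp]:
  "Obj (Q_cat C) = cospans C"
  "Hom (Q_cat C) K L = Hom (Aux C) K L Mod I_ideal C K L"
  "Ide (Q_cat C) K = Q.cls K K (Ide (Aux C) K)"
  by (simp_all add: Q_cat_def)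

lemma Q_comp_cls:
  "\<lbrakk>K \<in> cospans C; L \<in> cospans C; N \<in> cospans C;
    \<alpha> \<in> carrier (Hom (Aux C) K L); \<beta> \<in> carrier (Hom (Aux C) L N)\<rbrakk>
    \<Longrightarrow> Comp (Q_cat C) K L N (Q.cls K L \<alpha>) (Q.cls L N \<beta>) = Q.cls K N (Comp C (cA K) (cA L) (cA N) \<alpha> \<beta>)"
  unfolding Q_cat_def by (subst Q.cls_comp) simp_all

lemma cls_zero: "\<lbrakk>K \<in> cospans C; L \<in> cospans C\<rbrakk> \<Longrightarrow> Q.cls K L \<one>\<^bsub>Hom C (cA K) (cA L)\<^esub> = I_ideal C K L"
  using Q.cls_eq_ideal_iff[of K L "\<one>\<^bsub>Hom C (cA K) (cA L)\<^esub>"] Q.one_closed_hom[of K L]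
    subgroup.one_closed[OF Q.ideal_subgroup, of K L] by simp

text \<open>The identity of \<open>cA L\<close> and zero are both morphisms from \<open>L\<close> to
  \<open>N\<close>, and in Q(P) they agree after \<open>\<alpha>\<close>. Cancelling the epimorphism
  makes the identity a syzygy of \<open>N\<close>; by precomposition every morphism into
  \<open>cA L\<close> is one, so its class lies in the image of M(\<alpha>).\<close>

lemma M_mor_surj_if_epi:
  assumes K: "K \<in> cospans C" and L: "L \<in> cospans C" and a: "\<alpha> \<in> carrier (Hom (Aux C) K L)"
    and epi: "is_epi (Q_cat C) K L (Q.cls K L \<alpha>)" and X: "X \<in> Obj C"
  shows "M_mor C e K L \<alpha> X ` carrier (fobj (M K) X) = carrier (fobj (M L) X)"
proof -
  note KL = cospansD[OF K] cospansD[OF L] Hom_AuxD[OF a]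
  obtain N where N: "N \<in> cospans C" "cA N = cA L"
    and Syz_N: "\<And>X y. X \<in> Obj C \<Longrightarrow> y \<in> carrier (Hom C X (cA L)) \<Longrightarrow> (X, y) \<in> Syz C N \<longleftrightarrow>
      (\<exists>x\<in>carrier (Hom C X (cA K)). eps L X y = eps L X (Comp C X (cA K) (cA L) x \<alpha>))"
    and aux: "Ide C (cA L) \<in> carrier (Hom (Aux C) L N)" and aN: "(cA K, \<alpha>) \<in> Syz C N"
    using ex_cokernel_cospan_eps[OF K L a] by metis
  have zero: "\<one>\<^bsub>Hom C (cA L) (cA N)\<^esub> \<in> carrier (Hom (Aux C) L N)"
    using Q.one_closed_hom[of L N] L N by simp
  have "\<alpha> \<in> carrier (Hom (Aux C) K N)"
    using Q.comp_closed[of K L N \<alpha> "Ide C (cA L)"] K L N a aux KL by (simp add: comp_ide)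
  then have "Q.cls K N \<alpha> = I_ideal C K N"
    using K N aN by (simp add: Q.cls_eq_ideal_iff I_ideal_iff)
  then have eq: "Comp (Q_cat C) K L N (Q.cls K L \<alpha>) (Q.cls L N (Ide C (cA L)))
      = Comp (Q_cat C) K L N (Q.cls K L \<alpha>) (Q.cls L N \<one>\<^bsub>Hom C (cA L) (cA N)\<^esub>)"
    using K L N a aux zero KL by (simp add: Q_comp_cls comp_ide comp_zero cls_zero[of K N, unfolded N(2)])
  have "Q.cls L N (Ide C (cA L)) = Q.cls L N \<one>\<^bsub>Hom C (cA L) (cA N)\<^esub>"
    by (rule is_epiD[OF epi _ _ _ eq]) (use N aux zero in \<open>simp_all add: Q.carrier_quotient\<close>)
  then have "Ide C (cA L) \<in> I_ideal C L N"
    using cls_zero[OF L N(1)] L N(1) aux Q.cls_eq_ideal_iff[of L N "Ide C (cA L)"] by simp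
  then have id_N: "(cA L, Ide C (cA L)) \<in> Syz C N"
    using L by (simp add: I_ideal_iff)
  have "v \<in> M_mor C e K L \<alpha> X ` carrier (fobj (M K) X)" if v: "v \<in> carrier (fobj (M L) X)" for v
  proof -
    obtain y where y: "y \<in> carrier (Hom C X (cA L))" "v = eps L X y"
      using v by (metis M_elemE[OF L X])
    then have "(X, y) \<in> Syz C N"
      using Syz_precomp[OF N(1) X y(1) id_N] X KL N by (simp add: comp_ide)
    then obtain x where "x \<in> carrier (Hom C X (cA K))" "eps L X y = eps L X (Comp C X (cA K) (cA L) x \<alpha>)"
      using X y by (auto simp: Syz_N)
    then show ?thesis
      using K L X a y by (auto simp: M_mor_eps[symmetric] eps_closed)
  qed
  moreover have "M_mor C e K L \<alpha> X u \<in> carrier (fobj (M L) X)" if u: "u \<in> carrier (fobj (M K) X)" for u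
    using M_mor_nat[OF K L a] u X
    by (auto simp: nat_trans_Ab_iff[OF additive_functor_M[OF K] additive_functor_M[OF L]] intro: hom_in_carrier)
  ultimately show ?thesis by blast
qed

text \<open>The given cokernel \<open>J\<close> is identified with the test cospan \<open>N\<close>:
  the universal property yields \<open>\<phi>\<close> from \<open>J\<close> to \<open>N\<close>,
  \<open>\<kappa>\<close> itself is a morphism from \<open>N\<close> back to \<open>J\<close>, and
  the two are mutually inverse up to the ideals. Both claims about M are then read off from the
  syzygies of \<open>N\<close>.\<close>

lemma M_mor_cokernel:
  assumes K: "K \<in> cospans C" and L: "L \<in> cospans C" and a: "\<alpha> \<in> carrier (Hom (Aux C) K L)"
    and J: "J \<in> cospans C" and k: "\<kappa> \<in> carrier (Hom (Aux C) L J)"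
    and coker: "is_cokernel (Q_cat C) K L (Q.cls K L \<alpha>) J (Q.cls L J \<kappa>)" and X: "X \<in> Obj C"
  shows "M_mor C e L J \<kappa> X ` carrier (fobj (M L) X) = carrier (fobj (M J) X)"
    and "v \<in> carrier (fobj (M L) X) \<Longrightarrow>
      M_mor C e L J \<kappa> X v = \<one>\<^bsub>fobj (M J) X\<^esub> \<longleftrightarrow> v \<in> M_mor C e K L \<alpha> X ` carrier (fobj (M K) X)"
proof -
  note KL = cospansD[OF K] cospansD[OF L] cospansD[OF J] Hom_AuxD[OF a] Hom_AuxD[OF k]
  obtain N where N: "N \<in> cospans C" "cA N = cA L"
    and Syz_N: "\<And>X y. X \<in> Obj C \<Longrightarrow> y \<in> carrier (Hom C X (cA L)) \<Longrightarrow> (X, y) \<in> Syz C N \<longleftrightarrow>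
      (\<exists>x\<in>carrier (Hom C X (cA K)). eps L X y = eps L X (Comp C X (cA K) (cA L) x \<alpha>))"
    and id_aux: "Ide C (cA L) \<in> carrier (Hom (Aux C) L N)" and aN: "(cA K, \<alpha>) \<in> Syz C N"
    using ex_cokernel_cospan_eps[OF K L a] by metis
  have ak: "Comp C (cA K) (cA L) (cA J) \<alpha> \<kappa> \<in> carrier (Hom (Aux C) K J)"
    using Q.comp_closed[of K L J \<alpha> \<kappa>] K L J a k by simp
  have epi: "is_epi (Q_cat C) L J (Q.cls L J \<kappa>)"
    using preadditive_category.is_epi_if_cokernel[OF Q.preadditive_quotient[folded Q_cat_def] _ _ _ coker] K L a
    by (simp add: Q.carrier_quotient)
  have "Q.cls K J (Comp C (cA K) (cA L) (cA J) \<alpha> \<kappa>) = I_ideal C K J"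
    using coker K L J a k by (simp add: is_cokernel_def Q_comp_cls)
  then have akJ: "(cA K, Comp C (cA K) (cA L) (cA J) \<alpha> \<kappa>) \<in> Syz C J"
    using K J ak by (simp add: Q.cls_eq_ideal_iff I_ideal_iff)
  have aN': "\<alpha> \<in> carrier (Hom (Aux C) K N)"
    using Q.comp_closed[of K L N \<alpha> "Ide C (cA L)"] K L N a id_aux KL by (simp add: comp_ide)
  have "Comp (Q_cat C) K L N (Q.cls K L \<alpha>) (Q.cls L N (Ide C (cA L))) = \<one>\<^bsub>Hom (Q_cat C) K N\<^esub>"
    using K L N a id_aux aN aN' KL by (simp add: Q_comp_cls comp_ide Q.cls_eq_ideal_iff I_ideal_iff)
  \<comment> \<open>The universal property of \<open>J\<close> is applied to the identity of
    \<open>cA L\<close>, seen as a morphism from \<open>L\<close> to \<open>N\<close> that kills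
    \<open>\<alpha>\<close>.\<close>
  then obtain U where "U \<in> carrier (Hom (Q_cat C) J N)"
    "Comp (Q_cat C) L J N (Q.cls L J \<kappa>) U = Q.cls L N (Ide C (cA L))"
    using coker N id_aux L unfolding is_cokernel_def by (auto simp: Q.carrier_quotient) metis
  then obtain \<phi> where phi: "\<phi> \<in> carrier (Hom (Aux C) J N)"
    "Q.cls L N (Comp C (cA L) (cA J) (cA L) \<kappa> \<phi>) = Q.cls L N (Ide C (cA L))"
    using J N L k by (auto simp: Q.carrier_quotient Q_comp_cls)
  have phi': "\<phi> \<in> carrier (Hom C (cA J) (cA L))"
    using Hom_AuxD[OF phi(1)] N by simp
  have kphi: "Comp C (cA L) (cA J) (cA L) \<kappa> \<phi> \<in> carrier (Hom (Aux C) L N)"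
    using Q.comp_closed[of L J N \<kappa> \<phi>] J L N k phi by simp
  have eps_kphi: "eps N (cA L) (Comp C (cA L) (cA J) (cA L) \<kappa> \<phi>) = eps N (cA L) (Ide C (cA L))"
    using phi(2) kphi id_aux L N by (simp add: cls_eq_iff_eps)
  \<comment> \<open>A syzygy of \<open>N\<close> has the same class in M(L) as some x\<alpha>, and
    \<alpha>\<kappa> is a syzygy of \<open>J\<close>.\<close>
  have "\<kappa> \<in> carrier (Hom (Aux C) N J)"
    unfolding Hom_Aux_iff N(2)
  proof (intro conjI allI impI)
    fix S \<sigma> assume s: "(S, \<sigma>) \<in> Syz C N"
    note S = SyzD[OF s, unfolded N(2)]
    obtain x where x: "x \<in> carrier (Hom C S (cA K))" "eps L S \<sigma> = eps L S (Comp C S (cA K) (cA L) x \<alpha>)"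
      using s S by (auto simp: Syz_N)
    then have "eps J S (Comp C S (cA L) (cA J) \<sigma> \<kappa>)
        = eps J S (Comp C S (cA L) (cA J) (Comp C S (cA K) (cA L) x \<alpha>) \<kappa>)"
      using S KL by (intro eps_postcomp_cong[OF L J k]) (simp_all add: comp_closed)
    also have "\<dots> = \<one>\<^bsub>fobj (M J) S\<^esub>"
      using Syz_precomp[OF J S(1) x(1) akJ] S x KL J by (simp add: eps_eq_one_iff comp_closed comp_assoc)
    finally show "(S, Comp C S (cA L) (cA J) \<sigma> \<kappa>) \<in> Syz C J"
      using S KL J by (simp add: eps_eq_one_iff comp_closed)
  qed (fact KL)
  note psi = this
  have phipsi: "Comp C (cA J) (cA L) (cA J) \<phi> \<kappa> \<in> carrier (Hom (Aux C) J J)"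
    using Q.comp_closed[of J N J \<phi> \<kappa>] J N phi psi by simp
  have id_J: "Ide C (cA J) \<in> carrier (Hom (Aux C) J J)"
    using Q.ide_closed[of J] J by simp
  have "Q.cls L J \<kappa> = Comp (Q_cat C) L N J (Q.cls L N (Ide C (cA L))) (Q.cls N J \<kappa>)"
    using L J N id_aux psi KL by (simp add: Q_comp_cls ide_comp)
  also have "\<dots> = Comp (Q_cat C) L N J (Q.cls L N (Comp C (cA L) (cA J) (cA L) \<kappa> \<phi>)) (Q.cls N J \<kappa>)"
    by (simp add: phi)
  also have "\<dots> = Q.cls L J (Comp C (cA L) (cA J) (cA J) \<kappa> (Comp C (cA J) (cA L) (cA J) \<phi> \<kappa>))"
    using L J N kphi psi phi' KL by (simp add: Q_comp_cls comp_assoc)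
  finally have *: "Q.cls L J (Comp C (cA L) (cA J) (cA J) \<kappa> (Comp C (cA J) (cA L) (cA J) \<phi> \<kappa>))
      = Q.cls L J \<kappa>"
    by (rule sym)
  \<comment> \<open>As \<kappa>\<phi> is the identity modulo the ideal from \<open>L\<close> to
    \<open>N\<close>, following it by \<kappa> gives \<kappa>\<phi>\<kappa> = \<kappa> in Q(P); the
    epimorphism \<kappa> is then cancelled on the left.\<close>
  have eq: "Comp (Q_cat C) L J J (Q.cls L J \<kappa>) (Q.cls J J (Comp C (cA J) (cA L) (cA J) \<phi> \<kappa>))
      = Comp (Q_cat C) L J J (Q.cls L J \<kappa>) (Q.cls J J (Ide C (cA J)))"
    using J L k phipsi id_J KL by (simp add: Q_comp_cls comp_ide *)
  have "Q.cls J J (Comp C (cA J) (cA L) (cA J) \<phi> \<kappa>) = Q.cls J J (Ide C (cA J))"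
    by (rule is_epiD[OF epi _ _ _ eq]) (use J phipsi id_J in \<open>simp_all add: Q.carrier_quotient\<close>)
  then have eps_phipsi: "eps J (cA J) (Comp C (cA J) (cA L) (cA J) \<phi> \<kappa>) = eps J (cA J) (Ide C (cA J))"
    using phipsi id_J J by (simp add: cls_eq_iff_eps)
  have kX: "M_mor C e L J \<kappa> X u \<in> carrier (fobj (M J) X)" if u: "u \<in> carrier (fobj (M L) X)" for u
    using M_mor_nat[OF L J k] u X
    by (auto simp: nat_trans_Ab_iff[OF additive_functor_M[OF L] additive_functor_M[OF J]] intro: hom_in_carrier)
  \<comment> \<open>The class of z in M(J) equals that of z\<phi>\<kappa>, so the class of z\<phi>
    is a preimage.\<close>
  have "w \<in> M_mor C e L J \<kappa> X ` carrier (fobj (M L) X)" if w: "w \<in> carrier (fobj (M J) X)" for w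
  proof -
    obtain z where z: "z \<in> carrier (Hom C X (cA J))" "w = eps J X z"
      using w by (metis M_elemE[OF J X])
    have zphi: "Comp C X (cA J) (cA L) z \<phi> \<in> carrier (Hom C X (cA L))"
      using X z KL phi' by (simp add: comp_closed)
    have "w = eps J X (Comp C X (cA J) (cA J) z (Comp C (cA J) (cA L) (cA J) \<phi> \<kappa>))"
      using eps_precomp_cong[OF J KL(11) X z(1) _ _ eps_phipsi] z X KL phi' by (simp add: comp_ide comp_closed ide_closed)
    also have "\<dots> = M_mor C e L J \<kappa> X (eps L X (Comp C X (cA J) (cA L) z \<phi>))"
      using z X KL phi' zphi L J k by (simp add: M_mor_eps comp_assoc)
    finally show ?thesis
      using eps_closed[OF L X zphi] by blast
  qed
  with kX show "M_mor C e L J \<kappa> X ` carrier (fobj (M L) X) = carrier (fobj (M J) X)"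
    by blast
  assume "v \<in> carrier (fobj (M L) X)"
  then obtain y where y: "y \<in> carrier (Hom C X (cA L))" "v = eps L X y"
    by (metis M_elemE[OF L X])
  have yk: "Comp C X (cA L) (cA J) y \<kappa> \<in> carrier (Hom C X (cA J))"
    using y X KL by (simp add: comp_closed)
  have "M_mor C e L J \<kappa> X v = \<one>\<^bsub>fobj (M J) X\<^esub> \<longleftrightarrow> (X, Comp C X (cA L) (cA J) y \<kappa>) \<in> Syz C J"
    using y X L J k yk by (simp add: M_mor_eps eps_eq_one_iff)
  also have "\<dots> \<longleftrightarrow> (X, y) \<in> Syz C N"
  proof
    \<comment> \<open>Composing with \<phi> leads back to \<open>N\<close>, where y\<kappa>\<phi>
      and y have the same class.\<close>
    assume "(X, Comp C X (cA L) (cA J) y \<kappa>) \<in> Syz C J"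
    then have "(X, Comp C X (cA L) (cA L) y (Comp C (cA L) (cA J) (cA L) \<kappa> \<phi>)) \<in> Syz C N"
      using phi(1) X y KL phi' N by (simp add: Hom_Aux_iff flip: comp_assoc)
    moreover have "eps N X (Comp C X (cA L) (cA L) y (Comp C (cA L) (cA J) (cA L) \<kappa> \<phi>)) = eps N X y"
      using eps_precomp_cong[OF N(1) KL(6) X, unfolded N(2), OF y(1) _ _ eps_kphi] X y KL phi'
      by (simp add: comp_ide comp_closed ide_closed)
    ultimately show "(X, y) \<in> Syz C N"
      using X y KL phi' eps_eq_one_iff[OF N(1) X, unfolded N(2), of y]
        eps_eq_one_iff[OF N(1) X, unfolded N(2),
          of "Comp C X (cA L) (cA L) y (Comp C (cA L) (cA J) (cA L) \<kappa> \<phi>)"]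
      by (simp add: comp_closed)
  next
    assume "(X, y) \<in> Syz C N"
    then show "(X, Comp C X (cA L) (cA J) y \<kappa>) \<in> Syz C J"
      using psi N by (simp add: Hom_Aux_iff)
  qed
  also have "\<dots> \<longleftrightarrow> v \<in> M_mor C e K L \<alpha> X ` carrier (fobj (M K) X)"
  proof -
    have "v \<in> M_mor C e K L \<alpha> X ` carrier (fobj (M K) X) \<longleftrightarrow>
        (\<exists>x\<in>carrier (Hom C X (cA K)). v = M_mor C e K L \<alpha> X (eps K X x))"
      unfolding eps_surj[OF K X, symmetric] by blast
    then show ?thesis
      using X y K L a by (simp add: Syz_N M_mor_eps)
  qed
  finally show "M_mor C e L J \<kappa> X v = \<one>\<^bsub>fobj (M J) X\<^esub> \<longleftrightarrow> v \<in> M_mor C e K L \<alpha> X ` carrier (fobj (M K) X)" .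
qed

lemma preserves_cokernels_Mbar: "preserves_cokernels (Q_cat C) (Mod_cat C) Mbar.induced"
  unfolding preserves_cokernels_def
proof (intro ballI allI impI)
  fix K L U J V
  assume "K \<in> Obj (Q_cat C)" "L \<in> Obj (Q_cat C)" "U \<in> carrier (Hom (Q_cat C) K L)"
    and coker: "is_cokernel (Q_cat C) K L U J V"
  moreover from this have "J \<in> cospans C" "V \<in> carrier (Hom (Q_cat C) L J)"
    by (simp_all add: is_cokernel_def)
  ultimately obtain \<alpha> \<kappa> where KLJ: "K \<in> cospans C" "L \<in> cospans C" "J \<in> cospans C"
    and a: "\<alpha> \<in> carrier (Hom (Aux C) K L)" "U = Q.cls K L \<alpha>"
    and k: "\<kappa> \<in> carrier (Hom (Aux C) L J)" "V = Q.cls L J \<kappa>"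
    by (auto simp: Q.carrier_quotient)
  have "is_cokernel (Mod_cat C) (M K) (M L) (M_mor C e K L \<alpha>) (M J) (M_mor C e L J \<kappa>)"
    unfolding Mod_cat_def
    using KLJ a k coker M_mor_cokernel[OF KLJ(1,2) a(1) KLJ(3) k(1)]
    by (intro is_cokernel_functor_category_Ab additive_functor_M M_mor_nat) simp_all
  then show "is_cokernel (Mod_cat C) (fobj Mbar.induced K) (fobj Mbar.induced L) (fmor Mbar.induced K L U)
      (fobj Mbar.induced J) (fmor Mbar.induced L J V)"
    using KLJ a k by (simp add: fmor_Mbar)
qed

text \<open>The two factors of an epi-mono factorization are treated separately by the pointwise
  criteria; functoriality on Q(P) recombines them into a factorization of the image.\<close>

lemma preserves_images_Mbar: "preserves_images (Q_cat C) (Mod_cat C) Mbar.induced"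
  unfolding preserves_images_def
proof (intro ballI allI impI)
  fix K L U J V
  assume "K \<in> Obj (Q_cat C)" "L \<in> Obj (Q_cat C)" "U \<in> carrier (Hom (Q_cat C) K L)"
    and "is_image (Q_cat C) K L U J V"
  then obtain W where KLJ: "K \<in> cospans C" "L \<in> cospans C" "J \<in> cospans C"
    and V: "is_mono (Q_cat C) J L V" and W: "is_epi (Q_cat C) K J W"
    and U: "U = Comp (Q_cat C) K J L W V"
    by (auto simp: is_image_def)
  obtain \<epsilon> \<mu> where eps: "\<epsilon> \<in> carrier (Hom (Aux C) K J)" "W = Q.cls K J \<epsilon>"
    and mu: "\<mu> \<in> carrier (Hom (Aux C) J L)" "V = Q.cls J L \<mu>"
    using V W KLJ by (auto simp: is_mono_def is_epi_def Q.carrier_quotient)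
  have mono: "is_mono (Mod_cat C) (M J) (M L) (M_mor C e J L \<mu>)"
    unfolding Mod_cat_def using KLJ mu V
    by (intro is_mono_functor_category_Ab additive_functor_M M_mor_nat M_mor_inj_on_if_mono) simp_all
  have epi: "is_epi (Mod_cat C) (M K) (M J) (M_mor C e K J \<epsilon>)"
    unfolding Mod_cat_def using KLJ eps W
    by (intro is_epi_functor_category_Ab additive_functor_M M_mor_nat M_mor_surj_if_epi) simp_all
  have "fmor Mbar.induced K L U = Comp (Mod_cat C) (M K) (M J) (M L) (M_mor C e K J \<epsilon>) (M_mor C e J L \<mu>)"
    using additive_functor.fmor_comp[OF Mbar.additive_functor_induced, of K J L W V] KLJ eps mu
    by (simp add: U fmor_Mbar Q.carrier_quotient flip: Q_cat_def)
  then show "is_image (Mod_cat C) (fobj Mbar.induced K) (fobj Mbar.induced L) (fmor Mbar.induced K L U)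
      (fobj Mbar.induced J) (fmor Mbar.induced J L V)"
    using KLJ mu mono epi unfolding is_image_def
    by (auto simp: fmor_Mbar additive_functor_M simp del: Mod_cat_simps(3))
qed

lemma induces_Mbar: "induces C (M_functor C e) Mbar.induced"
  by (simp add: induces_def Q_class_def fmor_Mbar)

end

theorem theorem3p8:
  fixes P :: "('o, 'm) category" and e :: "'m set \<Rightarrow> 'u"
  assumes "additive_category P" and "inj e"
  shows "additive_functor (Aux P) (Mod_cat P) (M_functor P e) \<and>
    (\<exists>Mbar. additive_functor (Q_cat P) (Mod_cat P) Mbar \<and>
       induces P (M_functor P e) Mbar \<and>
       full_functor (Q_cat P) (Mod_cat P) Mbar \<and>
       faithful_functor (Q_cat P) (Mod_cat P) Mbar \<and>
       preserves_cokernels (Q_cat P) (Mod_cat P) Mbar \<and>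
       preserves_images (Q_cat P) (Mod_cat P) Mbar)"
proof -
  interpret additive_category P by fact
  interpret additive_cospan_modules P e
    by unfold_locales fact
  show ?thesis
    using additive_functor_M_functor Mbar.additive_functor_induced[folded Q_cat_def] induces_Mbar
      full_Mbar faithful_Mbar preserves_cokernels_Mbar preserves_images_Mbar
    by blast
qed

end
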